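(* Let $X,Y,Y_1,Y_2$ be Hilbert spaces and let $X_1\subset X$ be a convex subset of $X$. Let $L:Y_1\oplus Y_2\to Y$ be a continuous linear surjection. Let $F_i:X_1\to2^{Y_i}$, $i=1,2$, be uniformly continuous (with modulus $\omega_i$) set-valued mappings with convex closed bounded images, and let $d=\sup_{x\in X_1}\operatorname{diam}(F_1(x),F_2(x))<+\infty$. Suppose that $f:X_1\to Y$ is a Lipschitz selection, $f(x)\in L(F_1(x),F_2(x))$ for all $x\in X_1$. Then for any $\varepsilon>0$ there exist Lipschitz selections $f_i(x)\in F_i(x)+B^{Y_i}_\varepsilon(0)$, $i=1,2$, with $f(x)=L(f_1(x),f_2(x))$ for all $x\in X_1$.
   Context: Images are nonempty. $B^{Y_i}_\varepsilon(0)=\{y\in Y_i:\|y\|\le\varepsilon\}$. $(F_1(x),F_2(x))$ denotes the product set $F_1(x)\times F_2(x)\subset Y_1\oplus Y_2$ and $L(F_1(x),F_2(x))$ its image under $L$. $F_i$ is uniformly continuous with modulus $\omega_i:[0,+\infty)\to[0,+\infty)$ if $\lim_{t\to+0}\omega_i(t)=0$ and $h(F_i(x_1),F_i(x_2))\le\omega_i(\|x_1-x_2\|)$ for all $x_1,x_2\in X_1$, where $h(A,B)=\inf\{h>0 : A\subset B+B_h(0),\ B\subset A+B_h(0)\}$ is the Hausdorff distance. A Lipschitz selection of a set-valued mapping is a Lipschitz continuous single-valued function whose value at each point belongs to the image set at that point. *)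

theory Defs
  imports "HOL-Analysis.Analysis" "HOL-Library.Set_Algebras"
begin

text \<open>
  Here \<open>A + B\<close> is the Minkowski sum of sets.  The infimum is the expected one for nonempty
  bounded \<open>A\<close> and \<open>B\<close>; otherwise the set of radii can be empty and its real infimum is
  meaningless.
\<close>

definition hausdorff_distance :: "'a::real_normed_vector set \<Rightarrow> 'a set \<Rightarrow> real" where
  "hausdorff_distance A B =
     Inf {h. h > 0 \<and> A \<subseteq> B + cball 0 h \<and> B \<subseteq> A + cball 0 h}"

text \<open>A modulus is a function on \<open>[0, \<infinity>)\<close>: its values at negative reals are irrelevant, and
  no monotonicity or condition on \<open>\<omega> 0\<close> beyond nonnegativity is imposed.\<close>

definition uniformly_continuous_with_modulus ::
    "(real \<Rightarrow> real) \<Rightarrow> 'a::real_normed_vector set \<Rightarrow> ('a \<Rightarrow> 'b::real_normed_vector set) \<Rightarrow> bool" where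
  "uniformly_continuous_with_modulus \<omega> S F \<longleftrightarrow>
     (\<forall>t\<ge>0. \<omega> t \<ge> 0) \<and> (\<omega> \<longlongrightarrow> 0) (at_right 0) \<and>
     (\<forall>x\<in>S. \<forall>x'\<in>S. hausdorff_distance (F x) (F x') \<le> \<omega> (norm (x - x')))"

definition lipschitz_selection_on ::
    "'a::metric_space set \<Rightarrow> ('a \<Rightarrow> 'b::metric_space set) \<Rightarrow> ('a \<Rightarrow> 'b) \<Rightarrow> bool" where
  "lipschitz_selection_on S F f \<longleftrightarrow> (\<exists>C. C-lipschitz_on S f) \<and> (\<forall>x\<in>S. f x \<in> F x)"

end

theory Submission
  imports Defs
begin

text \<open>
  Put \<open>Z = Y\<^sub>1 \<oplus> Y\<^sub>2\<close> and \<open>G x = F\<^sub>1 x \<times> F\<^sub>2 x\<close>. A Lipschitz \<open>g\<close> with \<open>L (g x) = f x\<close> and \<open>g x\<close> near \<open>G x\<close> is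
  wanted; its two components are the desired selections. It is found in three moves.

  First, a selection that is only uniformly continuous. On the affine fibre \<open>L z = f x\<close> minimise
  \<open>sup\<^bsub>y \<in> G x\<^esub> |z - y|\<^sup>2 + K dist(z, G x)\<^sup>2\<close>. The supremum of squared distances makes this strongly
  convex in \<open>z\<close>, so that almost-minimisers at neighbouring points \<open>x\<close> are close to each other. It also
  measures positions relative to \<open>G x\<close>, so a set \<open>G x\<close> that wanders off to infinity does no harm. A
  point of \<open>G x\<close> on the fibre has value at most \<open>d\<^sup>2\<close>; hence a large \<open>K\<close> forces almost-minimisers to lie
  close to \<open>G x\<close>. The fibre over \<open>f x\<close> is carried to the fibre over \<open>f x'\<close> by a
  bounded linear right inverse \<open>R\<close> of \<open>L\<close>. This is \<open>uniformly_continuous_constrained_selection\<close>.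

  Second, a uniformly continuous map \<open>h\<close> from a convex set into a Hilbert space is uniformly close to
  Lipschitz maps (\<open>Lipschitz_approximation\<close>): subdividing segments shows that \<open>h\<close> is Lipschitz on a
  separated net, and Kirszbraun's theorem extends it from the net to the whole space. The extension
  is controlled by its Lipschitz constant times the mesh of the net, which is of the order of the
  oscillation of \<open>h\<close>.

  Third, a Lipschitz map \<open>k\<close> close to \<open>h\<close> satisfies the constraint \<open>L (k x) = f x\<close> only approximately.
  The correction \<open>x \<mapsto> k x + R (f x - L (k x))\<close> is Lipschitz, satisfies it exactly, and moves points
  little, because \<open>f - L k = L (h - k)\<close> is small.

  Kirszbraun's theorem, the closedness of \<open>L ` cball 0 r\<close> that yields bounded preimages, and the preimages
  of minimal norm that form \<open>R\<close> all rest on one compactness principle: in a Hilbert space, closed convex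
  sets with the finite intersection property, one of them bounded, have a common point.
\<close>

section \<open>Maximal sets of pairwise compatible points\<close>

text \<open>
  A family of sets that is defined by a condition on pairs is closed under unions of chains, so Zorn's
  lemma applies. Graphs of Lipschitz maps and separated nets are both of this kind.
\<close>

lemma exists_maximal_pairwise:
  assumes "A \<subseteq> U" "pairwise R A"
  obtains M where "A \<subseteq> M" "M \<subseteq> U" "pairwise R M"
    "\<And>x. \<lbrakk>x \<in> U; \<And>y. y \<in> M \<Longrightarrow> x \<noteq> y \<Longrightarrow> R x y \<and> R y x\<rbrakk> \<Longrightarrow> x \<in> M"
proof -
  let ?\<A> = "{M. A \<subseteq> M \<and> M \<subseteq> U \<and> pairwise R M}"
  have "\<exists>M\<in>?\<A>. \<forall>X\<in>?\<A>. M \<subseteq> X \<longrightarrow> X = M"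
  proof (rule subset_Zorn_nonempty)
    show "?\<A> \<noteq> {}" using assms by blast
    fix \<C> assume "\<C> \<noteq> {}" and ch: "subset.chain ?\<A> \<C>"
    have "chain\<^sub>\<subseteq> \<C>" using ch by (auto simp: subset_chain_def chain_subset_def)
    then have "pairwise R (\<Union>\<C>)"
      using ch by (intro pairwise_chain_Union) (auto simp: subset_chain_def)
    with ch \<open>\<C> \<noteq> {}\<close> show "\<Union>\<C> \<in> ?\<A>" by (fastforce simp: subset_chain_def)
  qed
  then obtain M where M: "A \<subseteq> M" "M \<subseteq> U" "pairwise R M"
    and max: "\<And>X. A \<subseteq> X \<Longrightarrow> X \<subseteq> U \<Longrightarrow> pairwise R X \<Longrightarrow> M \<subseteq> X \<Longrightarrow> X = M" by auto
  show thesis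
  proof
    fix x assume "x \<in> U" and x: "\<And>y. y \<in> M \<Longrightarrow> x \<noteq> y \<Longrightarrow> R x y \<and> R y x"
    have "pairwise R (insert x M)" using M x by (auto simp: pairwise_insert)
    then have "insert x M = M" using M \<open>x \<in> U\<close> by (intro max) auto
    then show "x \<in> M" by blast
  qed (use M in auto)
qed

section \<open>The finite intersection property for closed convex sets\<close>

lemma exists_near_infdist:
  fixes A :: "'a::metric_space set"
  assumes "A \<noteq> {}" "infdist z A < r"
  obtains y where "y \<in> A" "dist z y < r"
  using assms infdist_notempty[of A z] cINF_less_iff[of A "dist z" r] by auto

lemma norm_midpoint_sq:
  fixes a b :: "'a::real_inner"
  shows "(norm ((1/2) *\<^sub>R (a + b)))\<^sup>2 = (norm a)\<^sup>2 / 2 + (norm b)\<^sup>2 / 2 - (norm (a - b))\<^sup>2 / 4"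
  unfolding power2_norm_eq_inner by (simp add: inner_add inner_diff inner_commute field_simps)

text \<open>
  This is weak compactness, obtained from completeness and the parallelogram law. The distance \<open>\<nu> J\<close>
  from the origin to a finite intersection \<open>U J\<close> is bounded; let \<open>s\<close> be its supremum over \<open>J\<close>. If \<open>\<nu> J\<close> is
  close to \<open>s\<close>, then the part of \<open>U J\<close> inside a ball of radius slightly above \<open>s\<close> has small diameter, because
  the midpoint of two of its points again has norm at least \<open>\<nu> J\<close>. Along a sequence of such \<open>J\<close> these
  parts shrink to a single point, and adjoining any further set of the family does not move it.
\<close>

theorem Hilbert_closed_convex_fip:
  fixes C :: "'i \<Rightarrow> 'a::{real_inner,complete_space} set"
  assumes closed: "\<And>i. i \<in> I \<Longrightarrow> closed (C i)" and convex: "\<And>i. i \<in> I \<Longrightarrow> convex (C i)"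
    and k: "k \<in> I" "bounded (C k)"
    and fip: "\<And>J. \<lbrakk>finite J; J \<subseteq> I\<rbrakk> \<Longrightarrow> (\<Inter>i\<in>J. C i) \<noteq> {}"
  obtains p where "\<And>i. i \<in> I \<Longrightarrow> p \<in> C i"
proof -
  define U where "U J = (\<Inter>i\<in>insert k J. C i)" for J
  define \<nu> where "\<nu> J = infdist 0 (U J)" for J
  define \<F> where "\<F> = {J. finite J \<and> J \<subseteq> I}"
  have U_ne: "U J \<noteq> {}" if "J \<in> \<F>" for J
    using fip[of "insert k J"] that k by (auto simp: U_def \<F>_def)
  have U_closed: "closed (U J)" and U_convex: "convex (U J)" if "J \<in> \<F>" for J
    using that k closed convex unfolding U_def \<F>_def by (auto intro!: closed_INT convex_INT closed_Int convex_Int)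
  obtain b where b: "\<And>x. x \<in> C k \<Longrightarrow> norm x \<le> b"
    using k(2) unfolding bounded_iff by blast
  have \<nu>_le: "\<nu> J \<le> b" if "J \<in> \<F>" for J
  proof -
    obtain x where "x \<in> U J" using U_ne \<open>J \<in> \<F>\<close> by blast
    then show ?thesis using b[of x] infdist_le2[of x "U J" 0 b] by (auto simp: U_def \<nu>_def)
  qed
  define s where "s = (SUP J\<in>\<F>. \<nu> J)"
  have bdd: "bdd_above (\<nu> ` \<F>)" using \<nu>_le by (auto intro!: bdd_aboveI2)
  have "{} \<in> \<F>" by (simp add: \<F>_def)
  have \<nu>_le_s: "\<nu> J \<le> s" if "J \<in> \<F>" for J
    unfolding s_def using bdd that by (rule cSUP_upper2) simp
  have s0: "0 \<le> s" using \<nu>_le_s[OF \<open>{} \<in> \<F>\<close>] infdist_nonneg by (metis \<nu>_def order_trans)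
  have near: "\<exists>J\<in>\<F>. s - \<eta> < \<nu> J" if "\<eta> > 0" for \<eta>
    using less_cSUP_iff[of \<F> \<nu> "s - \<eta>"] bdd \<open>{} \<in> \<F>\<close> that unfolding s_def by auto
  define e where "e n = 1 / real (Suc n)" for n
  have e_pos: "e n > 0" for n by (simp add: e_def)
  have "\<forall>n. \<exists>J. J \<in> \<F> \<and> s - e n < \<nu> J" using near e_pos by blast
  then obtain J where J: "\<And>n. J n \<in> \<F>" "\<And>n. s - e n < \<nu> (J n)" by metis
  define K where "K n = (\<Union>m\<le>n. J m)" for n
  have K: "K n \<in> \<F>" for n using J(1) by (auto simp: K_def \<F>_def)
  have K_mono: "K m \<subseteq> K n" if "m \<le> n" for m n using that unfolding K_def by (intro UN_mono) auto
  \<comment> \<open>The midpoint lies in \<open>U (J n)\<close>, so its norm exceeds \<open>s - e n\<close>: the parallelogram law leaves little room.\<close>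
  have close: "(norm (p - q))\<^sup>2 \<le> 16 * s * e n + 4 * (e n)\<^sup>2"
    if pq: "p \<in> U (K n)" "q \<in> U (K n)" "norm p \<le> s + e n" "norm q \<le> s + e n" for p q n
  proof -
    let ?m = "(1/2) *\<^sub>R (p + q)"
    have "U (K n) \<subseteq> U (J n)" by (auto simp: U_def K_def)
    then have "p \<in> U (J n)" "q \<in> U (J n)" using pq by auto
    then have "?m \<in> U (J n)"
      using convexD[OF U_convex[OF J(1)], of p n q "1/2" "1/2"] by (simp add: scaleR_add_right)
    then have m: "\<nu> (J n) \<le> norm ?m" unfolding \<nu>_def using infdist_le[of ?m _ 0] by simp
    have "s\<^sup>2 - 2 * s * e n \<le> (norm ?m)\<^sup>2"
    proof (cases "s \<le> e n")
      case True
      then have "s * s \<le> s * (2 * e n)" using s0 e_pos[of n] by (intro mult_left_mono) auto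
      then have "s\<^sup>2 - 2 * s * e n \<le> 0" by (simp add: power2_eq_square algebra_simps)
      also have "0 \<le> (norm ?m)\<^sup>2" by simp
      finally show ?thesis .
    next
      case False
      then have "(s - e n)\<^sup>2 \<le> (norm ?m)\<^sup>2" using m J(2)[of n] by (intro power_mono) auto
      then show ?thesis using power2_diff[of s "e n"] zero_le_power2[of "e n"] by linarith
    qed
    moreover have "(norm p)\<^sup>2 \<le> (s + e n)\<^sup>2" "(norm q)\<^sup>2 \<le> (s + e n)\<^sup>2"
      using pq by (auto intro: power_mono)
    ultimately show ?thesis using norm_midpoint_sq[of p q]
      by (simp add: power2_sum algebra_simps)
  qed
  have lim: "(\<lambda>n. 16 * s * e n + 4 * (e n)\<^sup>2) \<longlonglongrightarrow> 0"
  proof -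
    have "e \<longlonglongrightarrow> 0" unfolding e_def using LIMSEQ_inverse_real_of_nat by (simp add: inverse_eq_divide)
    then show ?thesis by (auto intro!: tendsto_eq_intros)
  qed
  \<comment> \<open>Adjoining \<open>i\<close> keeps the sets nonempty, as every \<open>\<nu> J\<close> is at most \<open>s\<close>.\<close>
  define S where "S i n = U (insert i (K n)) \<inter> cball 0 (s + e n)" for i n
  have ex: "\<exists>a. \<forall>n. a \<in> S i n" if "i \<in> I" for i
  proof -
    have iK: "insert i (K n) \<in> \<F>" for n using K[of n] that by (auto simp: \<F>_def)
    have nonempty: "S i n \<noteq> {}" for n
    proof -
      have "infdist 0 (U (insert i (K n))) < s + e n"
        using \<nu>_le_s[OF iK, of n] e_pos[of n] by (simp add: \<nu>_def)
      then obtain y where "y \<in> U (insert i (K n))" "dist 0 y < s + e n"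
        using exists_near_infdist U_ne[OF iK] by metis
      then show ?thesis by (auto simp: S_def intro!: exI[of _ y])
    qed
    have decreasing: "S i n \<subseteq> S i m" if "m \<le> n" for m n
    proof -
      have "e n \<le> e m" using that by (simp add: e_def frac_le)
      moreover have "U (insert i (K n)) \<subseteq> U (insert i (K m))"
        using K_mono[OF that] unfolding U_def by (intro INF_superset_mono) auto
      ultimately show ?thesis unfolding S_def by (intro Int_mono subset_cball) auto
    qed
    have shrinking: "\<exists>n. \<forall>x\<in>S i n. \<forall>y\<in>S i n. dist x y < \<eta>" if "\<eta> > 0" for \<eta>
    proof -
      have "\<forall>\<^sub>F n in sequentially. 16 * s * e n + 4 * (e n)\<^sup>2 < \<eta>\<^sup>2"
        using order_tendstoD(2)[OF lim] that by simp
      then obtain n where n: "16 * s * e n + 4 * (e n)\<^sup>2 < \<eta>\<^sup>2"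
        by (auto simp: eventually_sequentially)
      have "dist x y < \<eta>" if "x \<in> S i n" "y \<in> S i n" for x y
      proof -
        have "(norm (x - y))\<^sup>2 < \<eta>\<^sup>2" using that close[of x n y] n by (auto simp: S_def U_def)
        then show ?thesis using \<open>\<eta> > 0\<close> power_less_imp_less_base[of "norm (x - y)" 2 \<eta>]
          by (simp add: dist_norm)
      qed
      then show ?thesis by blast
    qed
    have closed: "closed (S i n)" for n using U_closed[OF iK] by (auto simp: S_def)
    show ?thesis
      using decreasing_closed_nest[of "S i", OF closed nonempty decreasing shrinking] by metis
  qed
  obtain p where p: "\<And>n. p \<in> S k n" using ex[OF k(1)] by blast
  \<comment> \<open>The limit points belonging to \<open>k\<close> and to \<open>i\<close> lie in the same shrinking sets, hence coincide.\<close>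
  have "p \<in> C i" if i: "i \<in> I" for i
  proof -
    obtain q where q: "\<And>n. q \<in> S i n" using ex[OF i] by blast
    have "(norm (p - q))\<^sup>2 \<le> 16 * s * e n + 4 * (e n)\<^sup>2" for n
      using p[of n] q[of n] by (intro close) (auto simp: S_def U_def)
    then have "(norm (p - q))\<^sup>2 \<le> 0" using LIMSEQ_le_const[OF lim] by blast
    then have "p = q" by simp
    then show ?thesis using q[of 0] by (auto simp: S_def U_def)
  qed
  then show thesis by (rule that)
qed

corollary Hilbert_nested_closed_convex:
  fixes C :: "real \<Rightarrow> 'a::{real_inner,complete_space} set"
  assumes closed: "\<And>\<kappa>. \<kappa> > 0 \<Longrightarrow> closed (C \<kappa>)" and convex: "\<And>\<kappa>. \<kappa> > 0 \<Longrightarrow> convex (C \<kappa>)"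
    and "bounded (C 1)" and nonempty: "\<And>\<kappa>. \<kappa> > 0 \<Longrightarrow> C \<kappa> \<noteq> {}"
    and mono: "\<And>\<kappa> \<kappa>'. \<kappa> \<le> \<kappa>' \<Longrightarrow> C \<kappa> \<subseteq> C \<kappa>'"
  obtains p where "\<And>\<kappa>. \<kappa> > 0 \<Longrightarrow> p \<in> C \<kappa>"
proof -
  obtain p where "\<And>\<kappa>. \<kappa> \<in> {0<..} \<Longrightarrow> p \<in> C \<kappa>"
  proof (rule Hilbert_closed_convex_fip[of "{0<..}" C 1])
    fix J :: "real set" assume J: "finite J" "J \<subseteq> {0<..}"
    show "(\<Inter>\<kappa>\<in>J. C \<kappa>) \<noteq> {}"
    proof (cases "J = {}")
      case False
      then have "Min J > 0" using J Min_in by blast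
      moreover have "C (Min J) \<subseteq> (\<Inter>\<kappa>\<in>J. C \<kappa>)" using mono Min_le[OF J(1)] by blast
      ultimately show ?thesis using nonempty by blast
    qed auto
  qed (use assms in auto)
  then show thesis using that by auto
qed

section \<open>Kirszbraun's extension theorem\<close>

text \<open>
  The variance identity. It expresses the concave function in the next lemma through mutual
  distances, which is the form in which the hypothesis on the two families of points can be used.
\<close>

lemma weighted_pairwise_distances:
  fixes z :: "'i \<Rightarrow> 'a::real_inner"
  assumes "sum \<theta> J = 1"
  shows "(\<Sum>i\<in>J. \<Sum>j\<in>J. \<theta> i * \<theta> j * (norm (z i - z j))\<^sup>2)
       = 2 * (\<Sum>i\<in>J. \<theta> i * (norm (z i))\<^sup>2) - 2 * (norm (\<Sum>i\<in>J. \<theta> i *\<^sub>R z i))\<^sup>2"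
proof -
  have "(\<Sum>i\<in>J. \<Sum>j\<in>J. \<theta> i * \<theta> j * (norm (z i - z j))\<^sup>2)
      = (\<Sum>i\<in>J. \<Sum>j\<in>J. \<theta> j * (\<theta> i * (norm (z i))\<^sup>2) + \<theta> i * (\<theta> j * (norm (z j))\<^sup>2)
           - 2 * ((\<theta> i *\<^sub>R z i) \<bullet> (\<theta> j *\<^sub>R z j)))"
    unfolding power2_norm_eq_inner
    by (intro sum.cong refl) (simp add: inner_diff inner_commute algebra_simps)
  also have "\<dots> = 2 * (sum \<theta> J * (\<Sum>i\<in>J. \<theta> i * (norm (z i))\<^sup>2))
       - 2 * ((\<Sum>i\<in>J. \<theta> i *\<^sub>R z i) \<bullet> (\<Sum>j\<in>J. \<theta> j *\<^sub>R z j))"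
  proof -
    have "(\<Sum>i\<in>J. \<Sum>j\<in>J. (\<theta> i *\<^sub>R z i) \<bullet> (\<theta> j *\<^sub>R z j))
        = (\<Sum>i\<in>J. \<theta> i *\<^sub>R z i) \<bullet> (\<Sum>j\<in>J. \<theta> j *\<^sub>R z j)"
      unfolding inner_sum_left inner_sum_right by (rule sum.swap)
    moreover have "(\<Sum>i\<in>J. \<Sum>j\<in>J. \<theta> j * (\<theta> i * (norm (z i))\<^sup>2))
        = sum \<theta> J * (\<Sum>i\<in>J. \<theta> i * (norm (z i))\<^sup>2)"
      unfolding sum_product by (rule sum.swap)
    moreover have "(\<Sum>i\<in>J. \<Sum>j\<in>J. \<theta> i * (\<theta> j * (norm (z j))\<^sup>2))
        = sum \<theta> J * (\<Sum>i\<in>J. \<theta> i * (norm (z i))\<^sup>2)"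
      unfolding sum_product by (rule refl)
    ultimately show ?thesis
      unfolding sum_subtractf sum.distrib sum_distrib_left[symmetric] by linarith
  qed
  finally show ?thesis by (simp add: assms power2_norm_eq_inner)
qed

text \<open>
  Duality replaces the search for a point \<open>w\<close> in all balls \<open>cball (z i) (norm (x i))\<close> by the maximisation
  over weights \<open>\<theta>\<close> of the concave function \<open>D \<theta> = (\<Sum>i. \<theta> i * (|z i|\<^sup>2 - |x i|\<^sup>2)) - |W \<theta>|\<^sup>2\<close>, where \<open>W \<theta>\<close> is the
  barycentre of the \<open>z i\<close>. The variance identity and the comparison of distances give
  \<open>D \<theta> \<le> - |\<Sum>i. \<theta> i x i|\<^sup>2 \<le> 0\<close>. At a maximiser, the derivative of \<open>D\<close> towards the \<open>i\<close>-th vertex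
  is \<open>|z i - W \<theta>|\<^sup>2 - |x i|\<^sup>2 - D \<theta>\<close> and is not positive; so \<open>W \<theta>\<close> lies in every ball. An
  almost-maximiser, which always exists, gives the same up to an error \<open>\<kappa>\<close>.
\<close>

lemma approximate_common_point_of_balls:
  fixes x :: "'i \<Rightarrow> 'a::real_inner" and z :: "'i \<Rightarrow> 'b::real_inner"
  assumes J: "finite J" "J \<noteq> {}" and \<kappa>: "\<kappa> > 0"
    and short: "\<And>i j. i \<in> J \<Longrightarrow> j \<in> J \<Longrightarrow> norm (z i - z j) \<le> norm (x i - x j)"
  obtains w where "\<And>i. i \<in> J \<Longrightarrow> (norm (z i - w))\<^sup>2 \<le> (norm (x i))\<^sup>2 + \<kappa>"
proof -
  define \<Lambda> where "\<Lambda> = {\<theta>. (\<forall>i\<in>J. 0 \<le> \<theta> i) \<and> sum \<theta> J = (1::real)}"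
  define a where "a i = (norm (z i))\<^sup>2 - (norm (x i))\<^sup>2" for i
  define W where "W \<theta> = (\<Sum>i\<in>J. \<theta> i *\<^sub>R z i)" for \<theta>
  define D where "D \<theta> = (\<Sum>i\<in>J. \<theta> i * a i) - (norm (W \<theta>))\<^sup>2" for \<theta>
  have D_le_0: "D \<theta> \<le> 0" if \<theta>: "\<theta> \<in> \<Lambda>" for \<theta>
  proof -
    have s1: "sum \<theta> J = 1" using \<theta> by (simp add: \<Lambda>_def)
    have "(\<Sum>i\<in>J. \<Sum>j\<in>J. \<theta> i * \<theta> j * (norm (z i - z j))\<^sup>2)
        \<le> (\<Sum>i\<in>J. \<Sum>j\<in>J. \<theta> i * \<theta> j * (norm (x i - x j))\<^sup>2)"
      using \<theta> short by (intro sum_mono mult_left_mono power_mono) (auto simp: \<Lambda>_def)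
    then have "(\<Sum>i\<in>J. \<theta> i * (norm (z i))\<^sup>2) - (norm (W \<theta>))\<^sup>2
        \<le> (\<Sum>i\<in>J. \<theta> i * (norm (x i))\<^sup>2) - (norm (\<Sum>i\<in>J. \<theta> i *\<^sub>R x i))\<^sup>2"
      unfolding W_def weighted_pairwise_distances[OF s1] by simp
    moreover have "(\<Sum>i\<in>J. \<theta> i * a i)
        = (\<Sum>i\<in>J. \<theta> i * (norm (z i))\<^sup>2) - (\<Sum>i\<in>J. \<theta> i * (norm (x i))\<^sup>2)"
      by (simp add: a_def right_diff_distrib sum_subtractf)
    ultimately show ?thesis
      using zero_le_power2[of "norm (\<Sum>i\<in>J. \<theta> i *\<^sub>R x i)"] unfolding D_def by linarith
  qed
  obtain j where "j \<in> J" using J by blast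
  define \<delta> where "\<delta> i k = (if k = i then 1 else 0 :: real)" for i k :: 'i
  have "\<delta> j \<in> \<Lambda>" using \<open>j \<in> J\<close> J by (auto simp: \<Lambda>_def \<delta>_def)
  define B where "B = (\<Sum>i\<in>J. norm (z i))"
  have zB: "norm (z i) \<le> B" if "i \<in> J" for i
    unfolding B_def using J that by (intro member_le_sum) auto
  have WB: "norm (W \<theta>) \<le> B" if "\<theta> \<in> \<Lambda>" for \<theta>
  proof -
    have le1: "\<theta> i \<le> 1" if "i \<in> J" for i
      using member_le_sum[of i J \<theta>] J \<open>\<theta> \<in> \<Lambda>\<close> that by (auto simp: \<Lambda>_def)
    have "norm (W \<theta>) \<le> (\<Sum>i\<in>J. norm (\<theta> i *\<^sub>R z i))" unfolding W_def by (rule norm_sum)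
    also have "\<dots> \<le> B" unfolding B_def
      using le1 that by (intro sum_mono) (auto simp: \<Lambda>_def intro: mult_left_le_one_le)
    finally show ?thesis .
  qed
  define M where "M = (2 * B)\<^sup>2 + 1"
  have M: "M > 0" unfolding M_def by (simp add: add_nonneg_pos)
  \<comment> \<open>The step towards a vertex: a step \<open>t\<close> costs at most \<open>t\<^sup>2 M\<close> in the second-order term of \<open>D\<close>.\<close>
  define t where "t = min 1 (\<kappa> / (2 * M))"
  have t: "0 < t" "t \<le> 1" "t * M \<le> \<kappa> / 2" using \<kappa> M by (auto simp: t_def min_def field_simps)
  define s where "s = (SUP \<theta>\<in>\<Lambda>. D \<theta>)"
  have bdd: "bdd_above (D ` \<Lambda>)" using D_le_0 by (rule bdd_aboveI2)
  have "s - t * \<kappa> / 2 < s" using t \<kappa> by simp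
  then obtain \<theta> where \<theta>: "\<theta> \<in> \<Lambda>" "s - t * \<kappa> / 2 < D \<theta>"
    using less_cSUP_iff[OF _ bdd] \<open>\<delta> j \<in> \<Lambda>\<close> unfolding s_def by blast
  have "(norm (z i - W \<theta>))\<^sup>2 \<le> (norm (x i))\<^sup>2 + \<kappa>" if i: "i \<in> J" for i
  proof -
    define \<mu> where "\<mu> k = (1 - t) * \<theta> k + t * \<delta> i k" for k
    have sum_\<mu>: "(\<Sum>k\<in>J. \<mu> k * c k) = (1 - t) * (\<Sum>k\<in>J. \<theta> k * c k) + t * c i" for c :: "'i \<Rightarrow> real"
    proof -
      have "(\<Sum>k\<in>J. \<mu> k * c k) = (\<Sum>k\<in>J. (1 - t) * (\<theta> k * c k) + (if k = i then t * c i else 0))"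
        by (intro sum.cong refl) (auto simp: \<mu>_def \<delta>_def algebra_simps)
      then show ?thesis using i J by (simp add: sum.distrib flip: sum_distrib_left)
    qed
    have "W \<mu> = (1 - t) *\<^sub>R W \<theta> + (\<Sum>k\<in>J. if k = i then t *\<^sub>R z i else 0)"
      unfolding W_def \<mu>_def scaleR_sum_right sum.distrib[symmetric]
      by (intro sum.cong refl) (auto simp: \<delta>_def scaleR_add_left)
    then have W_\<mu>: "W \<mu> = W \<theta> + t *\<^sub>R (z i - W \<theta>)"
      using i J by (simp add: algebra_simps)
    have "sum \<mu> J = 1" using sum_\<mu>[of "\<lambda>_. 1"] \<theta>(1) by (simp add: \<Lambda>_def)
    then have "\<mu> \<in> \<Lambda>" using \<theta>(1) t by (auto simp: \<Lambda>_def \<mu>_def \<delta>_def)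
    then have "D \<mu> \<le> s" unfolding s_def using bdd by (intro cSUP_upper)
    moreover have "D \<mu> = D \<theta> + t * ((norm (z i - W \<theta>))\<^sup>2 - (norm (x i))\<^sup>2 - D \<theta>)
        - t * (t * (norm (z i - W \<theta>))\<^sup>2)"
      unfolding D_def sum_\<mu> W_\<mu> a_def power2_norm_eq_inner
      by (simp add: inner_add inner_diff inner_commute algebra_simps)
    ultimately have "t * ((norm (z i - W \<theta>))\<^sup>2 - (norm (x i))\<^sup>2 - D \<theta>)
        \<le> t * (\<kappa> / 2 + t * (norm (z i - W \<theta>))\<^sup>2)"
      using \<theta>(2) by (simp add: algebra_simps)
    then have "(norm (z i - W \<theta>))\<^sup>2 - (norm (x i))\<^sup>2 - D \<theta> \<le> \<kappa> / 2 + t * (norm (z i - W \<theta>))\<^sup>2"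
      using t(1) by simp
    moreover have "(norm (z i - W \<theta>))\<^sup>2 \<le> M"
    proof -
      have "norm (z i - W \<theta>) \<le> 2 * B"
        using norm_triangle_ineq4[of "z i" "W \<theta>"] zB[OF i] WB[OF \<theta>(1)] by linarith
      then have "(norm (z i - W \<theta>))\<^sup>2 \<le> (2 * B)\<^sup>2" by (intro power_mono) auto
      then show ?thesis by (simp add: M_def)
    qed
    then have "t * (norm (z i - W \<theta>))\<^sup>2 \<le> \<kappa> / 2" 
      using t mult_left_mono[of "(norm (z i - W \<theta>))\<^sup>2" M t] by linarith
    ultimately show ?thesis using D_le_0[OF \<theta>(1)] by linarith
  qed
  then show thesis by (rule that)
qed

text \<open>
  Balls of squared radius \<open>|x i|\<^sup>2 + \<kappa>\<close>, for all \<open>i\<close> and all \<open>\<kappa> > 0\<close> together, have the finite intersection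
  property. One appeal to compactness thus removes the error \<open>\<kappa>\<close> and the restriction to finitely many
  balls.
\<close>

lemma common_point_of_balls:
  fixes x :: "'i \<Rightarrow> 'a::real_inner" and z :: "'i \<Rightarrow> 'b::{real_inner,complete_space}"
  assumes short: "\<And>i j. i \<in> I \<Longrightarrow> j \<in> I \<Longrightarrow> norm (z i - z j) \<le> norm (x i - x j)"
  obtains w where "\<And>i. i \<in> I \<Longrightarrow> norm (z i - w) \<le> norm (x i)"
proof (cases "I = {}")
  case True
  then show thesis using that by blast
next
  case False
  then obtain k where k: "k \<in> I" by blast
  define C where "C = (\<lambda>(i, \<kappa>). cball (z i) (sqrt ((norm (x i))\<^sup>2 + \<kappa>)))"
  have ball: "w \<in> C (i, \<kappa>) \<longleftrightarrow> (norm (z i - w))\<^sup>2 \<le> (norm (x i))\<^sup>2 + \<kappa>" for w i \<kappa>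
  proof -
    have "norm (z i - w) \<le> sqrt c \<longleftrightarrow> (norm (z i - w))\<^sup>2 \<le> c" for c
      by (metis real_sqrt_le_iff real_sqrt_abs abs_norm_cancel)
    then show ?thesis by (simp add: C_def dist_norm)
  qed
  obtain w where w: "\<And>q. q \<in> I \<times> {0<..} \<Longrightarrow> w \<in> C q"
  proof (rule Hilbert_closed_convex_fip[of "I \<times> {0<..}" C "(k, 1)"])
    show "(k, 1::real) \<in> I \<times> {0<..}" "bounded (C (k, 1))" using k by (auto simp: C_def)
    fix J :: "('i \<times> real) set" assume J: "finite J" "J \<subseteq> I \<times> {0<..}"
    show "(\<Inter>q\<in>J. C q) \<noteq> {}"
    proof (cases "J = {}")
      case False
      define \<kappa> where "\<kappa> = Min (snd ` J)"
      have "\<kappa> \<in> snd ` J" unfolding \<kappa>_def using J False by (intro Min_in) auto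
      then have "\<kappa> > 0" using J by auto
      have "fst ` J \<subseteq> I" using J by auto
      then obtain w where "\<And>i. i \<in> fst ` J \<Longrightarrow> (norm (z i - w))\<^sup>2 \<le> (norm (x i))\<^sup>2 + \<kappa>"
        using approximate_common_point_of_balls[of "fst ` J" \<kappa> z x] J(1) False \<open>\<kappa> > 0\<close> short
        by (metis finite_imageI image_is_empty subsetD)
      moreover have "\<kappa> \<le> \<kappa>'" if "(i, \<kappa>') \<in> J" for i \<kappa>'
        unfolding \<kappa>_def using J that by (force intro: Min_le)
      ultimately have "w \<in> (\<Inter>q\<in>J. C q)" by (force simp: ball)
      then show ?thesis by blast
    qed auto
  qed (auto simp: C_def)
  show thesis
  proof
    fix i assume "i \<in> I"
    then have "(norm (z i - w))\<^sup>2 \<le> (norm (x i))\<^sup>2 + \<kappa>" if "\<kappa> > 0" for \<kappa>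
      using w[of "(i, \<kappa>)"] that by (simp add: ball)
    then have "(norm (z i - w))\<^sup>2 \<le> (norm (x i))\<^sup>2" by (rule field_le_epsilon)
    then show "norm (z i - w) \<le> norm (x i)" by (rule power2_le_imp_le) simp
  qed
qed

text \<open>
  A graph of a \<open>C\<close>-Lipschitz map that is maximal for inclusion is defined everywhere: a missing point \<open>x\<close>
  could be adjoined, since the balls of radius \<open>C * dist p x\<close> around the values at \<open>p\<close> have a common point.
\<close>

theorem Kirszbraun:
  fixes h :: "'a::real_inner \<Rightarrow> 'b::{real_inner,complete_space}"
  assumes h: "C-lipschitz_on N h"
  obtains g where "C-lipschitz_on UNIV g" "\<And>x. x \<in> N \<Longrightarrow> g x = h x"
proof -
  have C: "C \<ge> 0" using h by (rule lipschitz_on_nonneg)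
  define R :: "'a \<times> 'b \<Rightarrow> 'a \<times> 'b \<Rightarrow> bool"
    where "R p q \<longleftrightarrow> norm (snd p - snd q) \<le> norm (C *\<^sub>R fst p - C *\<^sub>R fst q)" for p q
  define G where "G = (\<lambda>x. (x, h x)) ` N"
  have R_iff: "R p q \<longleftrightarrow> dist (snd p) (snd q) \<le> C * dist (fst p) (fst q)" for p q
    using C by (simp add: R_def dist_norm flip: scaleR_diff_right)
  have "pairwise R G" using lipschitz_onD[OF h] by (auto simp: pairwise_def G_def R_iff)
  then obtain M where M: "G \<subseteq> M" "pairwise R M"
    and max: "\<And>p. (\<And>q. q \<in> M \<Longrightarrow> p \<noteq> q \<Longrightarrow> R p q \<and> R q p) \<Longrightarrow> p \<in> M"
    by (rule exists_maximal_pairwise[OF subset_UNIV]) auto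
  have R_M: "R p q" if "p \<in> M" "q \<in> M" for p q
    using M(2) that by (cases "p = q") (auto simp: pairwise_def R_def)
  have "\<exists>w. (x, w) \<in> M" for x
  proof -
    obtain w where "\<And>p. p \<in> M \<Longrightarrow> norm (snd p - w) \<le> norm (C *\<^sub>R (fst p - x))"
      by (rule common_point_of_balls[of M snd "\<lambda>p. C *\<^sub>R (fst p - x)"])
        (use R_M in \<open>auto simp: R_def algebra_simps\<close>)
    then have "(x, w) \<in> M"
      by (intro max) (auto simp: R_def norm_minus_commute algebra_simps)
    then show ?thesis ..
  qed
  then obtain g where g: "\<And>x. (x, g x) \<in> M" by metis
  show thesis
  proof
    show "C-lipschitz_on UNIV g"
      using C R_M[OF g g] by (intro lipschitz_onI) (auto simp: R_iff)
    fix x assume "x \<in> N"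
    then have "(x, h x) \<in> M" using M by (auto simp: G_def)
    then show "g x = h x" using R_M[OF g[of x], of "(x, h x)"] by (simp add: R_iff)
  qed
qed

section \<open>Bounded linear right inverses\<close>

text \<open>
  If \<open>y\<close> is a limit of images, then for every \<open>\<kappa> > 0\<close> the closed convex set of those \<open>z\<close> in the ball with
  \<open>L z\<close> within \<open>\<kappa>\<close> of \<open>y\<close> is nonempty; a common point of these sets is a preimage of \<open>y\<close>.
\<close>

lemma closed_linear_image_cball:
  fixes L :: "'a::{real_inner,complete_space} \<Rightarrow> 'b::real_normed_vector"
  assumes L: "bounded_linear L"
  shows "closed (L ` cball 0 r)"
proof -
  interpret bounded_linear L by (rule L)
  have "y \<in> L ` cball 0 r" if y: "y \<in> closure (L ` cball 0 r)" for y
  proof -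
    define C where "C \<kappa> = cball 0 r \<inter> L -` cball y \<kappa>" for \<kappa>
    have near: "C \<kappa> \<noteq> {}" if \<kappa>: "\<kappa> > 0" for \<kappa>
    proof -
      obtain z where "z \<in> cball 0 r" "dist (L z) y < \<kappa>"
        using y \<kappa> unfolding closure_approachable by blast
      then have "z \<in> C \<kappa>" by (simp add: C_def dist_commute)
      then show ?thesis by blast
    qed
    have "closed (C \<kappa>)" "convex (C \<kappa>)" for \<kappa>
      unfolding C_def by (intro closed_Int closed_cball continuous_closed_vimage
          linear_continuous_at[OF L] convex_Int convex_cball convex_linear_vimage linear_axioms)+
    moreover have "bounded (C 1)" by (simp add: C_def bounded_Int)
    moreover have "C \<kappa> \<subseteq> C \<kappa>'" if "\<kappa> \<le> \<kappa>'" for \<kappa> \<kappa>' using that by (auto simp: C_def)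
    ultimately obtain z where z: "\<And>\<kappa>. \<kappa> > 0 \<Longrightarrow> z \<in> C \<kappa>"
      using Hilbert_nested_closed_convex[of C] near by metis
    have "dist (L z) y \<le> 0 + \<kappa>" if "\<kappa> > 0" for \<kappa>
      using z[OF that] by (simp add: C_def dist_commute)
    then have "dist (L z) y \<le> 0" by (rule field_le_epsilon)
    then have "y = L z" by simp
    moreover have "z \<in> cball 0 r" using z[of 1] by (simp add: C_def)
    ultimately show ?thesis by (rule image_eqI)
  qed
  then have "closure (L ` cball 0 r) \<subseteq> L ` cball 0 r" by blast
  then show ?thesis by (simp add: closure_subset_eq)
qed

text \<open>
  By Baire, one of the closed sets \<open>L ` cball 0 n\<close>, which cover the space, contains a ball. Differences of
  preimages of its points are bounded preimages of a ball around the origin.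
\<close>

lemma bounded_preimages:
  fixes L :: "'a::{real_inner,complete_space} \<Rightarrow> 'b::{real_normed_vector,complete_space}"
  assumes L: "bounded_linear L" and "surj L"
  obtains B where "\<And>y. \<exists>z. L z = y \<and> norm z \<le> B * norm y"
proof -
  interpret bounded_linear L by (rule L)
  have "\<exists>n. interior (L ` cball 0 (real n)) \<noteq> {}"
  proof (rule ccontr)
    assume "\<not> ?thesis"
    then have "euclidean interior_of (\<Union>n. L ` cball 0 (real n)) = {}"
      using closed_linear_image_cball[OF L] completely_metrizable_space_euclidean
      by (intro Baire_category_alt) auto
    moreover have "y \<in> (\<Union>n. L ` cball 0 (real n))" for y
    proof -
      obtain z where "y = L z" using \<open>surj L\<close> by (rule surjE)
      moreover obtain n :: nat where "norm z \<le> real n" using real_arch_simple by blast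
      ultimately have "y \<in> L ` cball 0 (real n)" by simp
      then show ?thesis by blast
    qed
    then have "(\<Union>n. L ` cball 0 (real n)) = UNIV" by blast
    ultimately show False by simp
  qed
  then obtain n y\<^sub>0 where "y\<^sub>0 \<in> interior (L ` cball 0 (real n))" by blast
  then obtain r where r: "r > 0" "cball y\<^sub>0 r \<subseteq> L ` cball 0 (real n)"
    unfolding mem_interior_cball by blast
  have "y\<^sub>0 \<in> cball y\<^sub>0 r" using r by simp
  then obtain z\<^sub>0 where z\<^sub>0: "y\<^sub>0 = L z\<^sub>0" "norm z\<^sub>0 \<le> n"
    using r(2) by (metis imageE mem_cball_0 subsetD)
  show thesis
  proof
    fix y show "\<exists>z. L z = y \<and> norm z \<le> (2 * n / r) * norm y"
    proof (cases "y = 0")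
      case True
      then show ?thesis using zero by (intro exI[of _ 0]) auto
    next
      case False
      let ?c = "r / norm y"
      have "y\<^sub>0 + ?c *\<^sub>R y \<in> cball y\<^sub>0 r" using r False by (simp add: dist_norm)
      then have "y\<^sub>0 + ?c *\<^sub>R y \<in> L ` cball 0 (real n)" using r(2) by blast
      then obtain z where z: "y\<^sub>0 + ?c *\<^sub>R y = L z" "z \<in> cball 0 (real n)" by (rule imageE)
      let ?z = "(norm y / r) *\<^sub>R (z - z\<^sub>0)"
      have "L z - L z\<^sub>0 = ?c *\<^sub>R y" using z(1) z\<^sub>0(1) by (metis add_diff_cancel_left')
      then have "L ?z = y" using r False by (simp add: scaleR diff)
      moreover have "norm (z - z\<^sub>0) \<le> 2 * n" using z\<^sub>0 z(2) norm_triangle_ineq4[of z z\<^sub>0] by simp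
      then have "norm ?z \<le> (norm y / r) * (2 * n)"
        using r by (simp add: mult_left_mono divide_right_mono)
      ultimately show ?thesis by (intro exI[of _ ?z]) (simp add: mult_ac)
    qed
  qed
qed

text \<open>
  A preimage of minimal norm is orthogonal to the kernel, as moving it along the kernel cannot shorten it.
  Unlike minimality, orthogonality is visibly preserved by linear combinations.
\<close>

lemma orthogonal_preimage:
  fixes L :: "'a::{real_inner,complete_space} \<Rightarrow> 'b::real_normed_vector"
  assumes L: "bounded_linear L" and "surj L"
  obtains z where "L z = y" "\<And>k. L k = 0 \<Longrightarrow> z \<bullet> k = 0"
proof -
  interpret bounded_linear L by (rule L)
  define V where "V = L -` {y}"
  have V_ne: "V \<noteq> {}" using surjD[OF \<open>surj L\<close>, of y] by (auto simp: V_def)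
  define m where "m = infdist 0 V"
  define C where "C \<kappa> = V \<inter> cball 0 (m + \<kappa>)" for \<kappa>
  have near: "C \<kappa> \<noteq> {}" if \<kappa>: "\<kappa> > 0" for \<kappa>
  proof -
    have "infdist 0 V < m + \<kappa>" using \<kappa> by (simp add: m_def)
    then obtain z where "z \<in> V" "dist 0 z < m + \<kappa>" using exists_near_infdist[OF V_ne] by blast
    then have "z \<in> C \<kappa>" by (simp add: C_def)
    then show ?thesis by blast
  qed
  have "closed (C \<kappa>)" "convex (C \<kappa>)" for \<kappa>
    unfolding C_def V_def by (intro closed_Int closed_cball closed_singleton continuous_closed_vimage
        linear_continuous_at[OF L] convex_Int convex_cball convex_linear_vimage linear_axioms
        convex_singleton)+
  moreover have "bounded (C 1)" by (simp add: C_def bounded_Int)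
  moreover have "C \<kappa> \<subseteq> C \<kappa>'" if "\<kappa> \<le> \<kappa>'" for \<kappa> \<kappa>' using that by (auto simp: C_def)
  ultimately obtain z where z: "\<And>\<kappa>. \<kappa> > 0 \<Longrightarrow> z \<in> C \<kappa>"
    using Hilbert_nested_closed_convex[of C] near by metis
  have "norm z \<le> m + \<kappa>" if "\<kappa> > 0" for \<kappa> using z[OF that] by (simp add: C_def)
  then have "norm z \<le> m" by (rule field_le_epsilon)
  have "L z = y" using z[of 1] by (simp add: C_def V_def)
  moreover have "z \<bullet> k = 0" if k: "L k = 0" for k
  proof (cases "k = 0")
    case False
    \<comment> \<open>The multiple of \<open>k\<close> that makes \<open>z + t k\<close> as short as possible.\<close>
    define t where "t = - (z \<bullet> k) / (k \<bullet> k)"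
    have "z + t *\<^sub>R k \<in> V" using \<open>L z = y\<close> k by (simp add: V_def add scaleR)
    then have "m \<le> norm (z + t *\<^sub>R k)" unfolding m_def using infdist_le[of "z + t *\<^sub>R k" V 0] by simp
    then have "(norm z)\<^sup>2 \<le> (norm (z + t *\<^sub>R k))\<^sup>2" using \<open>norm z \<le> m\<close> by (intro power_mono) auto
    also have "\<dots> = (norm z)\<^sup>2 + (2 * t * (z \<bullet> k) + t\<^sup>2 * (k \<bullet> k))"
      unfolding power2_norm_eq_inner by (simp add: inner_add inner_commute power2_eq_square algebra_simps)
    also have "2 * t * (z \<bullet> k) + t\<^sup>2 * (k \<bullet> k) = - ((z \<bullet> k)\<^sup>2 / (k \<bullet> k))"
      using False by (simp add: t_def power2_eq_square field_simps)
    finally have "(z \<bullet> k)\<^sup>2 / (k \<bullet> k) \<le> 0" by simp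
    moreover have "k \<bullet> k > 0" using False by simp
    ultimately show ?thesis
      by (simp only: pos_divide_le_eq mult_zero_left power2_less_eq_zero_iff)
  qed simp
  ultimately show thesis by (rule that)
qed

text \<open>
  The preimage orthogonal to the kernel is unique, hence depends linearly on \<open>y\<close>; by Pythagoras it is
  the shortest preimage, hence inherits the bound for arbitrary preimages.
\<close>

theorem bounded_linear_right_inverse:
  fixes L :: "'a::{real_inner,complete_space} \<Rightarrow> 'b::{real_normed_vector,complete_space}"
  assumes L: "bounded_linear L" and "surj L"
  obtains R where "bounded_linear R" "\<And>y. L (R y) = y"
proof -
  interpret bounded_linear L by (rule L)
  have "\<forall>y. \<exists>z. L z = y \<and> (\<forall>k. L k = 0 \<longrightarrow> z \<bullet> k = 0)"
    using orthogonal_preimage[OF assms] by metis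
  then obtain R where LR: "\<And>y. L (R y) = y" and orth: "\<And>y k. L k = 0 \<Longrightarrow> R y \<bullet> k = 0" by metis
  have unique: "R y = z" if "L z = y" "\<And>k. L k = 0 \<Longrightarrow> z \<bullet> k = 0" for y z
  proof -
    have k: "L (R y - z) = 0" using that LR by (simp add: diff)
    have "(R y - z) \<bullet> (R y - z) = 0"
      using orth[OF k] that(2)[OF k] by (simp only: inner_diff_left)
    then show ?thesis by simp
  qed
  obtain B where B: "\<And>y. \<exists>z. L z = y \<and> norm z \<le> B * norm y"
    using bounded_preimages[OF assms] by blast
  have "bounded_linear R"
  proof (rule bounded_linear_intro)
    show "R (x + y) = R x + R y" for x y
      by (rule unique) (simp_all add: LR add orth inner_add_left)
    show "R (c *\<^sub>R x) = c *\<^sub>R R x" for c x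
      by (rule unique) (simp_all add: LR scaleR orth)
    show "norm (R y) \<le> norm y * B" for y
    proof -
      obtain z where z: "L z = y" "norm z \<le> B * norm y" using B by blast
      have "R y \<bullet> (z - R y) = 0" by (intro orth) (simp add: diff LR z)
      then have "(norm (R y))\<^sup>2 + (norm (z - R y))\<^sup>2 = (norm z)\<^sup>2"
        unfolding power2_norm_eq_inner by (simp add: inner_diff inner_commute)
      then have "(norm (R y))\<^sup>2 \<le> (norm z)\<^sup>2" using zero_le_power2[of "norm (z - R y)"] by linarith
      then have "norm (R y) \<le> norm z" by (rule power2_le_imp_le) simp
      then show ?thesis using z by (simp add: mult.commute)
    qed
  qed
  then show thesis using LR by (rule that)
qed

section \<open>Lipschitz approximation of uniformly continuous maps\<close>

text \<open>
  A segment of length at most \<open>k * t\<close> splits into \<open>k\<close> pieces of length at most \<open>t\<close>. This is where the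
  convexity of the domain enters.
\<close>

lemma convex_chaining:
  fixes h :: "'a::real_normed_vector \<Rightarrow> 'b::metric_space"
  assumes "convex X" and h: "\<And>x y. \<lbrakk>x \<in> X; y \<in> X; dist x y \<le> t\<rbrakk> \<Longrightarrow> dist (h x) (h y) \<le> \<sigma>"
    and "x \<in> X" "y \<in> X" "dist x y \<le> real k * t"
  shows "dist (h x) (h y) \<le> real k * \<sigma>"
  using assms(3,5)
proof (induction k arbitrary: x)
  case 0
  then show ?case by simp
next
  case (Suc k)
  define u where "u = 1 / real (Suc k)"
  have u: "0 \<le> u" "u \<le> 1" "u * real (Suc k) = 1" "1 - u = u * real k" by (simp_all add: u_def field_simps)
  define w where "w = (1 - u) *\<^sub>R x + u *\<^sub>R y"
  have "w \<in> X" unfolding w_def using Suc.prems(1) assms(1,4) u by (intro convexD) auto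
  have "x - w = u *\<^sub>R (x - y)" "w - y = (1 - u) *\<^sub>R (x - y)" by (simp_all add: w_def algebra_simps)
  then have xw: "dist x w = u * dist x y" and wy: "dist w y = (1 - u) * dist x y"
    using u by (simp_all add: dist_norm)
  have le: "u * dist x y \<le> u * (real (Suc k) * t)" using Suc.prems(2) u(1) by (rule mult_left_mono)
  also have "\<dots> = t" using u(3) by (simp flip: mult.assoc)
  finally have "dist x w \<le> t" using xw by simp
  then have "dist (h x) (h w) \<le> \<sigma>" using h Suc.prems(1) \<open>w \<in> X\<close> by blast
  moreover have "dist w y \<le> real k * t"
    using mult_left_mono[OF \<open>dist x w \<le> t\<close>, of "real k"] by (simp add: wy u(4) xw mult_ac)
  then have "dist (h w) (h y) \<le> real k * \<sigma>" by (rule Suc.IH[OF \<open>w \<in> X\<close>])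
  ultimately show ?case using dist_triangle[of "h x" "h y" "h w"] by (simp add: algebra_simps)
qed

text \<open>
  On a net with mutual distances at least \<open>t\<close>, chaining bounds the increments of \<open>h\<close> by
  \<open>(dist x y / t + 1) * \<sigma> \<le> (2 * \<sigma> / t) * dist x y\<close>. A maximal net meets every ball of radius \<open>t\<close>, so the Kirszbraun
  extension from the net differs from \<open>h\<close> by at most \<open>2 * \<sigma>\<close> (its variation over a distance \<open>t\<close>) plus \<open>\<sigma>\<close> (that of \<open>h\<close>).
\<close>

theorem Lipschitz_approximation:
  fixes h :: "'a::real_inner \<Rightarrow> 'b::{real_inner,complete_space}"
  assumes "convex X" "t > 0"
    and h: "\<And>x y. \<lbrakk>x \<in> X; y \<in> X; dist x y \<le> t\<rbrakk> \<Longrightarrow> dist (h x) (h y) \<le> \<sigma>"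
  obtains g C where "C-lipschitz_on UNIV g" "\<And>x. x \<in> X \<Longrightarrow> dist (g x) (h x) \<le> 3 * \<sigma>"
proof (cases "X = {}")
  case True
  then show thesis using that[of 0 "\<lambda>_. 0"] by (simp add: lipschitz_on_constant)
next
  case False
  then obtain x\<^sub>0 where "x\<^sub>0 \<in> X" by blast
  have \<sigma>: "\<sigma> \<ge> 0" using h[OF \<open>x\<^sub>0 \<in> X\<close> \<open>x\<^sub>0 \<in> X\<close>] \<open>t > 0\<close> by simp
  obtain N where N: "N \<subseteq> X" "pairwise (\<lambda>x y. t \<le> dist x y) N"
    and max: "\<And>x. x \<in> X \<Longrightarrow> (\<And>y. y \<in> N \<Longrightarrow> x \<noteq> y \<Longrightarrow> t \<le> dist x y \<and> t \<le> dist y x) \<Longrightarrow> x \<in> N"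
    by (rule exists_maximal_pairwise[of "{}" X "\<lambda>x y. t \<le> dist x y"]) auto
  define C where "C = 2 * \<sigma> / t"
  have C: "C \<ge> 0" "C * t = 2 * \<sigma>" using \<sigma> \<open>t > 0\<close> by (simp_all add: C_def)
  have "C-lipschitz_on N h"
  proof (rule lipschitz_onI)
    fix x y assume xy: "x \<in> N" "y \<in> N"
    show "dist (h x) (h y) \<le> C * dist x y"
    proof (cases "x = y")
      case False
      then have "t \<le> dist x y" using N xy by (auto simp: pairwise_def)
      then have ge1: "1 \<le> dist x y / t" using \<open>t > 0\<close> by simp
      define k where "k = nat \<lceil>dist x y / t\<rceil>"
      have k: "dist x y / t \<le> real k" "real k \<le> dist x y / t + 1" using ge1 unfolding k_def by linarith+
      have "dist x y \<le> real k * t" using k(1) \<open>t > 0\<close> by (simp add: field_simps)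
      then have "dist (h x) (h y) \<le> real k * \<sigma>"
        using xy N(1) by (intro convex_chaining[OF \<open>convex X\<close> h]) auto
      also have "\<dots> \<le> (2 * (dist x y / t)) * \<sigma>"
        using k(2) ge1 \<sigma> by (intro mult_right_mono) auto
      finally show ?thesis by (simp add: C_def mult_ac)
    qed simp
  qed (rule C)
  then obtain g where g: "C-lipschitz_on UNIV g" "\<And>x. x \<in> N \<Longrightarrow> g x = h x"
    using Kirszbraun by blast
  have "dist (g x) (h x) \<le> 3 * \<sigma>" if "x \<in> X" for x
  proof -
    have "\<exists>n\<in>N. dist x n \<le> t"
    proof (rule ccontr)
      assume "\<not> ?thesis"
      then have far: "t < dist x n" if "n \<in> N" for n using that by (auto simp: not_le)
      then have "x \<in> N" using \<open>x \<in> X\<close> by (intro max) (auto simp: dist_commute less_imp_le)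
      then show False using far[of x] \<open>t > 0\<close> by simp
    qed
    then obtain n where n: "n \<in> N" "dist x n \<le> t" by blast
    have "dist (g x) (g n) \<le> C * t"
      using lipschitz_onD[OF g(1), of x n] mult_left_mono[OF n(2) C(1)] by simp
    moreover have "dist (h n) (h x) \<le> \<sigma>" using n N that by (intro h) (auto simp: dist_commute)
    ultimately show ?thesis using dist_triangle[of "g x" "h x" "g n"] g(2)[OF n(1)] C(2) by simp
  qed
  with g(1) show thesis by (rule that)
qed

section \<open>A strongly convex functional attached to a bounded convex set\<close>

text \<open>
  The squared radius of the smallest ball around \<open>z\<close> that contains \<open>A\<close> (the functional whose minimiser
  is the Chebyshev centre) plus a penalty for leaving \<open>A\<close>.
\<close>

definition spread_penalty :: "real \<Rightarrow> 'a::metric_space set \<Rightarrow> 'a \<Rightarrow> real"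
  where "spread_penalty K A z = (SUP y\<in>A. (dist z y)\<^sup>2) + K * (infdist z A)\<^sup>2"

lemma bdd_above_dist_sq:
  fixes A :: "'a::metric_space set"
  assumes "bounded A"
  shows "bdd_above ((\<lambda>y. (dist z y)\<^sup>2) ` A)"
proof -
  obtain e where "\<forall>y\<in>A. dist z y \<le> e" using assms bounded_any_center by blast
  then show ?thesis by (intro bdd_aboveI2[of _ _ "e\<^sup>2"]) (simp add: power_mono)
qed

lemma dist_sq_le_spread_penalty:
  assumes "bounded A" "K \<ge> 0" "y \<in> A"
  shows "(dist z y)\<^sup>2 + K * (infdist z A)\<^sup>2 \<le> spread_penalty K A z"
  unfolding spread_penalty_def using cSUP_upper[OF assms(3) bdd_above_dist_sq[OF assms(1)]] by simp

lemma spread_penalty_le: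
  assumes "p \<in> A" "\<And>y. y \<in> A \<Longrightarrow> dist p y \<le> d"
  shows "spread_penalty K A p \<le> d\<^sup>2"
proof -
  have "(SUP y\<in>A. (dist p y)\<^sup>2) \<le> d\<^sup>2"
    using assms by (intro cSUP_least) (auto intro: power_mono)
  then show ?thesis using assms(1) by (simp add: spread_penalty_def)
qed

lemma infdist_midpoint_le:
  fixes A :: "'a::real_normed_vector set"
  assumes "convex A" "A \<noteq> {}"
  shows "infdist ((1/2) *\<^sub>R (z + w)) A \<le> (infdist z A + infdist w A) / 2"
proof (rule field_le_epsilon)
  fix e :: real assume "e > 0"
  then obtain a b where a: "a \<in> A" "dist z a < infdist z A + e" and b: "b \<in> A" "dist w b < infdist w A + e"
    using exists_near_infdist[OF assms(2)] by (metis less_add_same_cancel1)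
  let ?c = "(1/2) *\<^sub>R (a + b)"
  have "?c \<in> A" using convexD[OF assms(1) a(1) b(1), of "1/2" "1/2"] by (simp add: scaleR_add_right)
  then have "infdist ((1/2) *\<^sub>R (z + w)) A \<le> norm ((1/2) *\<^sub>R ((z - a) + (w - b)))"
    using infdist_le[of ?c A "(1/2) *\<^sub>R (z + w)"] by (simp add: dist_norm algebra_simps)
  also have "\<dots> \<le> (dist z a + dist w b) / 2"
    using norm_triangle_ineq[of "z - a" "w - b"] by (simp add: dist_norm)
  also have "\<dots> \<le> ((infdist z A + e) + (infdist w A + e)) / 2"
    using a(2) b(2) by (intro divide_right_mono add_mono) auto
  also have "\<dots> = (infdist z A + infdist w A) / 2 + e" by (simp add: field_simps)
  finally show "infdist ((1/2) *\<^sub>R (z + w)) A \<le> (infdist z A + infdist w A) / 2 + e" .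
qed

text \<open>
  Each \<open>(dist z y)\<^sup>2\<close> is strongly convex in \<open>z\<close> with the same modulus, so their supremum is as well;
  the penalty is convex because \<open>A\<close> is.
\<close>

lemma spread_penalty_strongly_convex:
  fixes A :: "'a::real_inner set"
  assumes A: "convex A" "A \<noteq> {}" "bounded A" and K: "K \<ge> 0"
  shows "spread_penalty K A ((1/2) *\<^sub>R (z + w))
       \<le> spread_penalty K A z / 2 + spread_penalty K A w / 2 - (norm (z - w))\<^sup>2 / 4"
proof -
  let ?m = "(1/2) *\<^sub>R (z + w)"
  define s where "s v = (SUP y\<in>A. (dist v y)\<^sup>2)" for v
  have upper: "(dist v y)\<^sup>2 \<le> s v" if "y \<in> A" for v y
    unfolding s_def using bdd_above_dist_sq[OF A(3)] that by (intro cSUP_upper)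
  have "s ?m \<le> s z / 2 + s w / 2 - (norm (z - w))\<^sup>2 / 4"
    unfolding s_def[of ?m]
  proof (rule cSUP_least[OF A(2)])
    fix y assume "y \<in> A"
    have "?m - y = (1/2) *\<^sub>R ((z - y) + (w - y))" by (simp add: algebra_simps flip: scaleR_2)
    then have "(dist ?m y)\<^sup>2 = (dist z y)\<^sup>2 / 2 + (dist w y)\<^sup>2 / 2 - (norm (z - w))\<^sup>2 / 4"
      using norm_midpoint_sq[of "z - y" "w - y"] by (simp add: dist_norm)
    then show "(dist ?m y)\<^sup>2 \<le> s z / 2 + s w / 2 - (norm (z - w))\<^sup>2 / 4"
      using upper[OF \<open>y \<in> A\<close>, of z] upper[OF \<open>y \<in> A\<close>, of w] by linarith
  qed
  moreover have "(infdist ?m A)\<^sup>2 \<le> (infdist z A)\<^sup>2 / 2 + (infdist w A)\<^sup>2 / 2"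
  proof -
    let ?p = "infdist z A" and ?q = "infdist w A"
    have "(infdist ?m A)\<^sup>2 \<le> ((?p + ?q) / 2)\<^sup>2"
      using infdist_midpoint_le[OF A(1,2)] infdist_nonneg by (intro power_mono) auto
    also have "\<dots> \<le> ?p\<^sup>2 / 2 + ?q\<^sup>2 / 2"
      using zero_le_power2[of "?p - ?q"] by (simp add: power2_eq_square field_simps)
    finally show ?thesis .
  qed
  then have "K * (infdist ?m A)\<^sup>2 \<le> K * ((infdist z A)\<^sup>2 / 2 + (infdist w A)\<^sup>2 / 2)"
    using K by (rule mult_left_mono)
  ultimately show ?thesis unfolding spread_penalty_def s_def
    by (simp add: distrib_left add_divide_distrib)
qed

text \<open>
  Moving the point and the set by a total of \<open>\<kappa>\<close> changes all distances involved by at most \<open>\<kappa>\<close>. These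
  distances are bounded by \<open>S\<close>, so their squares change by at most \<open>2 * S * \<kappa> + \<kappa>\<^sup>2\<close>.
\<close>

lemma spread_penalty_shift:
  fixes A B :: "'a::metric_space set"
  assumes A: "A \<noteq> {}" "bounded A" and B: "B \<noteq> {}"
    and AB: "\<And>a. a \<in> A \<Longrightarrow> \<exists>b\<in>B. dist a b \<le> \<eta>" and BA: "\<And>b. b \<in> B \<Longrightarrow> \<exists>a\<in>A. dist b a \<le> \<eta>"
    and \<kappa>: "dist z w + \<eta> \<le> \<kappa>" "0 \<le> \<kappa>" "\<kappa> \<le> 1" and K: "K \<ge> 0" and S: "S \<ge> 0" "spread_penalty K A z \<le> S\<^sup>2"
  shows "spread_penalty K B w \<le> spread_penalty K A z + (1 + K) * (\<kappa> * (2 * S + 1))"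
proof -
  have sq: "(r + \<kappa>)\<^sup>2 \<le> r\<^sup>2 + \<kappa> * (2 * S + 1)" if "0 \<le> r" "r \<le> S" for r
  proof -
    have "\<kappa> * r \<le> \<kappa> * S" "\<kappa> * \<kappa> \<le> \<kappa> * 1" using mult_left_mono[OF that(2) \<kappa>(2)] mult_left_mono[OF \<kappa>(3) \<kappa>(2)] by auto
    then show ?thesis by (simp add: power2_eq_square algebra_simps)
  qed
  have zS: "dist z a \<le> S" if "a \<in> A" for a
  proof -
    have "0 \<le> K * (infdist z A)\<^sup>2" using K by simp
    then have "(dist z a)\<^sup>2 \<le> S\<^sup>2"
      using dist_sq_le_spread_penalty[OF A(2) K that, of z] S(2) by linarith
    then show ?thesis using S(1) by (rule power2_le_imp_le)
  qed
  have "(SUP b\<in>B. (dist w b)\<^sup>2) \<le> (SUP a\<in>A. (dist z a)\<^sup>2) + \<kappa> * (2 * S + 1)"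
  proof (rule cSUP_least[OF B])
    fix b assume "b \<in> B"
    then obtain a where a: "a \<in> A" "dist b a \<le> \<eta>" using BA by blast
    have "dist w b \<le> dist z a + \<kappa>"
      using dist_triangle[of w b z] dist_triangle[of z b a] a(2) \<kappa>(1) by (simp add: dist_commute)
    then have "(dist w b)\<^sup>2 \<le> (dist z a + \<kappa>)\<^sup>2" by (intro power_mono) auto
    also have "\<dots> \<le> (dist z a)\<^sup>2 + \<kappa> * (2 * S + 1)" using zS[OF a(1)] by (intro sq) auto
    also have "(dist z a)\<^sup>2 \<le> (SUP a\<in>A. (dist z a)\<^sup>2)"
      using bdd_above_dist_sq[OF A(2)] a(1) by (intro cSUP_upper)
    finally show "(dist w b)\<^sup>2 \<le> (SUP a\<in>A. (dist z a)\<^sup>2) + \<kappa> * (2 * S + 1)" by simp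
  qed
  moreover have "(infdist w B)\<^sup>2 \<le> (infdist z A)\<^sup>2 + \<kappa> * (2 * S + 1)"
  proof -
    have "infdist w B \<le> infdist z A + \<kappa>"
    proof (rule field_le_epsilon)
      fix e :: real assume "e > 0"
      then obtain a where a: "a \<in> A" "dist z a < infdist z A + e"
        using exists_near_infdist[OF A(1)] by (metis less_add_same_cancel1)
      obtain b where "b \<in> B" "dist a b \<le> \<eta>" using AB a(1) by blast
      then show "infdist w B \<le> infdist z A + \<kappa> + e"
        using infdist_le[of b B w] dist_triangle[of w b z] dist_triangle[of z b a] a(2) \<kappa>(1)
        by (simp add: dist_commute)
    qed
    then have "(infdist w B)\<^sup>2 \<le> (infdist z A + \<kappa>)\<^sup>2"
      using infdist_nonneg by (intro power_mono)
    moreover obtain a where "a \<in> A" using A(1) by blast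
    then have "infdist z A \<le> S" using zS infdist_le by (meson order_trans)
    ultimately show ?thesis using sq[of "infdist z A"] infdist_nonneg[of z A] by linarith
  qed
  then have "K * (infdist w B)\<^sup>2 \<le> K * ((infdist z A)\<^sup>2 + \<kappa> * (2 * S + 1))"
    using K by (rule mult_left_mono)
  ultimately show ?thesis unfolding spread_penalty_def by (simp add: algebra_simps)
qed

section \<open>Splitting with a linear constraint\<close>

text \<open>
  The point \<open>h x\<close> minimises \<open>Q x\<close> up to \<open>\<tau>\<close> over the fibre \<open>V x\<close> of \<open>L\<close> above \<open>f x\<close>. For \<open>x'\<close> near \<open>x\<close>, the point
  \<open>z = h x + R (f x' - f x)\<close> lies in \<open>V x'\<close> and \<open>Q x' z\<close> is almost \<open>Q x (h x)\<close>. The roles of \<open>x\<close> and \<open>x'\<close> being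
  symmetric, the minimal values over the two fibres almost agree, so \<open>z\<close> and \<open>h x'\<close> are both
  almost-minimisers over the convex fibre \<open>V x'\<close> and strong convexity brings them together.
\<close>

lemma uniformly_continuous_constrained_selection:
  fixes G :: "'x::metric_space \<Rightarrow> 'z::real_inner set" and f :: "'x \<Rightarrow> 'y::real_normed_vector"
  assumes L: "bounded_linear L" and R: "bounded_linear R" and LR: "\<And>y. L (R y) = y"
    and G: "\<And>x. x \<in> X \<Longrightarrow> convex (G x) \<and> bounded (G x)"
    and d: "\<And>x y y'. \<lbrakk>x \<in> X; y \<in> G x; y' \<in> G x\<rbrakk> \<Longrightarrow> dist y y' \<le> d"
    and uc: "\<And>\<eta>. \<eta> > 0 \<Longrightarrow> \<exists>\<delta>>0. \<forall>x\<in>X. \<forall>x'\<in>X. dist x x' < \<delta> \<longrightarrow> (\<forall>y\<in>G x. \<exists>y'\<in>G x'. dist y y' \<le> \<eta>)"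
    and f: "C-lipschitz_on X f" "\<And>x. x \<in> X \<Longrightarrow> f x \<in> L ` G x"
    and "\<epsilon> > 0" "\<sigma> > 0"
  obtains h t where "\<And>x. x \<in> X \<Longrightarrow> L (h x) = f x" "\<And>x. x \<in> X \<Longrightarrow> infdist (h x) (G x) \<le> \<epsilon>"
    "t > 0" "\<And>x x'. \<lbrakk>x \<in> X; x' \<in> X; dist x x' \<le> t\<rbrakk> \<Longrightarrow> dist (h x) (h x') \<le> \<sigma>"
proof -
  interpret L: bounded_linear L by (rule L)
  interpret R: bounded_linear R by (rule R)
  \<comment> \<open>\<open>K\<close> is chosen such that \<open>K * (infdist z (G x))\<^sup>2 \<le> d\<^sup>2 + 1\<close> means \<open>infdist z (G x) \<le> \<epsilon>\<close>.\<close>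
  define K where "K = (d\<^sup>2 + 1) / \<epsilon>\<^sup>2"
  define S where "S = \<bar>d\<bar> + 1"
  define Q where "Q x = spread_penalty K (G x)" for x
  define V where "V x = {z. L z = f x}" for x
  define m where "m x = (INF z\<in>V x. Q x z)" for x
  define \<tau> where "\<tau> = min 1 (\<sigma>\<^sup>2 / 48)"
  have K: "K \<ge> 0" by (simp add: K_def)
  have K\<epsilon>: "K * \<epsilon>\<^sup>2 = d\<^sup>2 + 1" using \<open>\<epsilon> > 0\<close> by (simp add: K_def)
  have S: "S \<ge> 0" "d\<^sup>2 + 1 \<le> S\<^sup>2" by (simp_all add: S_def power2_sum)
  have \<tau>: "0 < \<tau>" "\<tau> \<le> 1" "6 * \<tau> \<le> \<sigma>\<^sup>2 / 8" using \<open>\<sigma> > 0\<close> by (auto simp: \<tau>_def min_def)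
  have ne: "G x \<noteq> {}" if "x \<in> X" for x using f(2)[OF that] by auto
  have Q_nonneg: "0 \<le> Q x z" if x: "x \<in> X" for x z
  proof -
    obtain y where "y \<in> G x" using ne[OF x] by blast
    then have "(dist z y)\<^sup>2 + K * (infdist z (G x))\<^sup>2 \<le> Q x z"
      unfolding Q_def using G[OF x] K by (intro dist_sq_le_spread_penalty) auto
    moreover have "0 \<le> (dist z y)\<^sup>2 + K * (infdist z (G x))\<^sup>2" using K by simp
    ultimately show ?thesis by linarith
  qed
  have bdd: "bdd_below (Q x ` V x)" if "x \<in> X" for x
    using Q_nonneg[OF that] by (intro bdd_belowI2)
  have m_le: "m x \<le> Q x z" if "x \<in> X" "z \<in> V x" for x z
    unfolding m_def using bdd[OF that(1)] that(2) by (intro cINF_lower)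
  have m_le_d: "m x \<le> d\<^sup>2" if x: "x \<in> X" for x
  proof -
    obtain p where p: "p \<in> G x" "L p = f x" using f(2)[OF x] by auto
    have "Q x p \<le> d\<^sup>2" unfolding Q_def using p(1) d[OF x p(1)] by (rule spread_penalty_le)
    moreover have "m x \<le> Q x p" using p x by (intro m_le) (auto simp: V_def)
    ultimately show ?thesis by simp
  qed
  have "\<exists>z. x \<in> X \<longrightarrow> z \<in> V x \<and> Q x z < m x + \<tau>" for x
  proof (cases "x \<in> X")
    case True
    have "V x \<noteq> {}" using LR by (auto simp: V_def)
    then show ?thesis
      using cINF_less_iff[OF _ bdd[OF True], of "m x + \<tau>"] \<tau>(1) unfolding m_def by auto
  qed auto
  then obtain h where h: "\<And>x. x \<in> X \<Longrightarrow> h x \<in> V x" "\<And>x. x \<in> X \<Longrightarrow> Q x (h x) < m x + \<tau>"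
    by metis
  have Qh: "Q x (h x) \<le> d\<^sup>2 + 1" if "x \<in> X" for x
    using h(2)[OF that] m_le_d[OF that] \<tau>(2) by linarith
  have infdist_h: "infdist (h x) (G x) \<le> \<epsilon>" if x: "x \<in> X" for x
  proof -
    obtain y where y: "y \<in> G x" using ne[OF x] by blast
    have "(dist (h x) y)\<^sup>2 + K * (infdist (h x) (G x))\<^sup>2 \<le> Q x (h x)"
      unfolding Q_def using G[OF x] K y by (intro dist_sq_le_spread_penalty) auto
    then have "K * (infdist (h x) (G x))\<^sup>2 \<le> K * \<epsilon>\<^sup>2"
      using Qh[OF x] zero_le_power2[of "dist (h x) y"] unfolding K\<epsilon> by linarith
    moreover have "K > 0" unfolding K_def using \<open>\<epsilon> > 0\<close> by (intro divide_pos_pos) (auto intro: add_nonneg_pos)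
    ultimately have "(infdist (h x) (G x))\<^sup>2 \<le> \<epsilon>\<^sup>2" by simp
    then show ?thesis by (rule power2_le_imp_le) (use \<open>\<epsilon> > 0\<close> in simp)
  qed
  define M where "M = (1 + K) * (2 * S + 1)"
  have M: "M > 0" unfolding M_def using K S(1) by (intro mult_pos_pos) auto
  \<comment> \<open>\<open>\<tau>\<close> and \<open>\<kappa>\<close> are such that the final estimate \<open>6 * \<tau> + 4 * (\<kappa> * M)\<close> is at most \<open>(\<sigma> / 2)\<^sup>2\<close>.\<close>
  define \<kappa> where "\<kappa> = min 1 (\<sigma>\<^sup>2 / (32 * M))"
  have \<kappa>: "0 < \<kappa>" "\<kappa> \<le> 1" "4 * (\<kappa> * M) \<le> \<sigma>\<^sup>2 / 8"
    using \<open>\<sigma> > 0\<close> M by (auto simp: \<kappa>_def min_def field_simps)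
  define \<rho> where "\<rho> = min (\<kappa> / 2) (\<sigma> / 2)"
  have \<rho>: "\<rho> > 0" "\<rho> \<le> \<kappa> / 2" "\<rho> \<le> \<sigma> / 2" using \<kappa>(1) \<open>\<sigma> > 0\<close> by (auto simp: \<rho>_def)
  obtain \<delta> where \<delta>: "\<delta> > 0"
    "\<And>x x' y. \<lbrakk>x \<in> X; x' \<in> X; dist x x' < \<delta>; y \<in> G x\<rbrakk> \<Longrightarrow> \<exists>y'\<in>G x'. dist y y' \<le> \<kappa> / 2"
    using uc[of "\<kappa> / 2"] \<kappa>(1) by auto
  obtain B where B: "B > 0" "\<And>y. norm (R y) \<le> norm y * B" using R.pos_bounded by blast
  have C: "C \<ge> 0" using f(1) by (rule lipschitz_on_nonneg)
  define t where "t = min (\<delta> / 2) (\<rho> / (C * B + 1))"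
  have CB: "C * B + 1 > 0" using C B by (simp add: add_nonneg_pos)
  have t: "t > 0" "t < \<delta>" using \<delta>(1) \<rho>(1) CB unfolding t_def by auto
  have "t \<le> \<rho> / (C * B + 1)" by (simp add: t_def)
  then have t_le: "t * (C * B + 1) \<le> \<rho>" using CB by (simp only: pos_le_divide_eq)
  have move: "norm (R (f x' - f x)) \<le> \<rho>" if "x \<in> X" "x' \<in> X" "dist x x' \<le> t" for x x'
  proof -
    have "norm (R (f x' - f x)) \<le> norm (f x' - f x) * B" by (rule B(2))
    also have "\<dots> \<le> (C * dist x' x) * B"
      using lipschitz_onD[OF f(1) that(2,1)] B(1) by (intro mult_right_mono) (auto simp: dist_norm)
    also have "\<dots> \<le> (C * t) * B"
      using that(3) C B(1) by (intro mult_right_mono mult_left_mono) (auto simp: dist_commute)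
    also have "\<dots> \<le> \<rho>" using t(1) t_le by (simp add: algebra_simps)
    finally show ?thesis .
  qed
  have transfer: "h x + R (f x' - f x) \<in> V x' \<and> Q x' (h x + R (f x' - f x)) \<le> Q x (h x) + \<kappa> * M"
    if x: "x \<in> X" and x': "x' \<in> X" and xx': "dist x x' \<le> t" for x x'
  proof
    show "h x + R (f x' - f x) \<in> V x'" using h(1)[OF x] by (simp add: V_def L.add LR)
    have "Q x' (h x + R (f x' - f x)) \<le> Q x (h x) + (1 + K) * (\<kappa> * (2 * S + 1))"
      unfolding Q_def
    proof (rule spread_penalty_shift[where \<eta> = "\<kappa> / 2"])
      show "dist (h x) (h x + R (f x' - f x)) + \<kappa> / 2 \<le> \<kappa>"
        using move[OF x x' xx'] \<rho>(2) by (simp add: dist_norm)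
      show "spread_penalty K (G x) (h x) \<le> S\<^sup>2" using Qh[OF x] S(2) unfolding Q_def by linarith
      show "\<exists>b\<in>G x'. dist a b \<le> \<kappa> / 2" if "a \<in> G x" for a
        using \<delta>(2)[OF x x' _ that] xx' t(2) by linarith
      show "\<exists>a\<in>G x. dist b a \<le> \<kappa> / 2" if "b \<in> G x'" for b
        using \<delta>(2)[OF x' x _ that] xx' t(2) by (simp add: dist_commute)
    qed (use G[OF x] ne[OF x] ne[OF x'] \<kappa> K S in auto)
    then show "Q x' (h x + R (f x' - f x)) \<le> Q x (h x) + \<kappa> * M" by (simp add: M_def mult_ac)
  qed
  have "dist (h x) (h x') \<le> \<sigma>" if x: "x \<in> X" and x': "x' \<in> X" and xx': "dist x x' \<le> t" for x x'
  proof -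
    define z where "z = h x + R (f x' - f x)"
    have z: "z \<in> V x'" "Q x' z \<le> Q x (h x) + \<kappa> * M" using transfer[OF x x' xx'] by (auto simp: z_def)
    have "m x \<le> Q x' (h x') + \<kappa> * M"
      using transfer[OF x' x] xx' m_le[OF x] by (metis dist_commute order_trans)
    then have Qz: "Q x' z \<le> m x' + 2 * \<tau> + 2 * (\<kappa> * M)"
      using z(2) h(2)[OF x] h(2)[OF x'] by linarith
    \<comment> \<open>The midpoint lies on the fibre, so its value is at least \<open>m x'\<close>; strong convexity bounds the gap.\<close>
    let ?w = "(1/2) *\<^sub>R (z + h x')"
    have "?w \<in> V x'" using z(1) h(1)[OF x'] by (simp add: V_def L.add L.scaleR flip: scaleR_2)
    then have "m x' \<le> Q x' ?w" by (rule m_le[OF x'])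
    also have "\<dots> \<le> Q x' z / 2 + Q x' (h x') / 2 - (norm (z - h x'))\<^sup>2 / 4"
      unfolding Q_def using G[OF x'] ne[OF x'] K by (intro spread_penalty_strongly_convex) auto
    finally have "(norm (z - h x'))\<^sup>2 \<le> 2 * Q x' z + 2 * Q x' (h x') - 4 * m x'" by simp
    also have "\<dots> \<le> 6 * \<tau> + 4 * (\<kappa> * M)" using Qz h(2)[OF x'] by simp
    also have "\<dots> \<le> (\<sigma> / 2)\<^sup>2" using \<tau>(3) \<kappa>(3) by (simp add: power_divide)
    finally have "norm (z - h x') \<le> \<sigma> / 2" by (rule power2_le_imp_le) (use \<open>\<sigma> > 0\<close> in simp)
    moreover have "norm (h x - z) \<le> \<sigma> / 2" using move[OF x x' xx'] \<rho>(3) by (simp add: z_def)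
    ultimately show ?thesis
      using norm_triangle_ineq[of "h x - z" "z - h x'"] by (simp add: dist_norm)
  qed
  moreover have "L (h x) = f x" if "x \<in> X" for x using h(1)[OF that] by (simp add: V_def)
  ultimately show thesis using that infdist_h t(1) by blast
qed

text \<open>
  The Lipschitz approximation \<open>k\<close> of a uniformly continuous selection \<open>h\<close> is pushed back onto the fibres of
  \<open>L\<close> by \<open>R\<close>.
\<close>

theorem Lipschitz_splitting:
  fixes X :: "'x::real_inner set"
    and L :: "'z::{real_inner,complete_space} \<Rightarrow> 'y::{real_normed_vector,complete_space}"
  assumes "convex X" and L: "bounded_linear L" "surj L"
    and G: "\<And>x. x \<in> X \<Longrightarrow> convex (G x) \<and> bounded (G x)"
    and d: "\<And>x y y'. \<lbrakk>x \<in> X; y \<in> G x; y' \<in> G x\<rbrakk> \<Longrightarrow> dist y y' \<le> d"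
    and uc: "\<And>\<eta>. \<eta> > 0 \<Longrightarrow> \<exists>\<delta>>0. \<forall>x\<in>X. \<forall>x'\<in>X. dist x x' < \<delta> \<longrightarrow> (\<forall>y\<in>G x. \<exists>y'\<in>G x'. dist y y' \<le> \<eta>)"
    and f: "C-lipschitz_on X f" "\<And>x. x \<in> X \<Longrightarrow> f x \<in> L ` G x"
    and "\<epsilon> > 0"
  obtains g D where "D-lipschitz_on X g" "\<And>x. x \<in> X \<Longrightarrow> L (g x) = f x"
    "\<And>x. x \<in> X \<Longrightarrow> infdist (g x) (G x) < \<epsilon>"
proof -
  obtain R where R: "bounded_linear R" and LR: "\<And>y. L (R y) = y"
    using bounded_linear_right_inverse[OF L] by blast
  interpret L: bounded_linear L by (rule L)
  interpret R: bounded_linear R by (rule R)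
  obtain A where A: "A > 0" "\<And>z. norm (R (L z)) \<le> norm z * A"
    using bounded_linear.pos_bounded[OF bounded_linear_compose[OF R L(1)]] by blast
  \<comment> \<open>\<open>3 * \<sigma>\<close> is the error of the approximation and \<open>3 * \<sigma> * A\<close> that of the correction.\<close>
  define \<sigma> where "\<sigma> = \<epsilon> / (12 * (1 + A))"
  have "\<sigma> * (12 * (1 + A)) = \<epsilon>" using A(1) by (simp add: \<sigma>_def)
  then have "3 * \<sigma> + 3 * \<sigma> * A = \<epsilon> / 4" by (simp add: algebra_simps)
  moreover have "\<sigma> > 0" using \<open>\<epsilon> > 0\<close> A(1) by (simp add: \<sigma>_def)
  ultimately have \<sigma>: "\<sigma> > 0" "3 * \<sigma> + 3 * \<sigma> * A = \<epsilon> / 4" by auto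
  have half: "\<epsilon> / 2 > 0" using \<open>\<epsilon> > 0\<close> by simp
  obtain h t where h: "\<And>x. x \<in> X \<Longrightarrow> L (h x) = f x" "\<And>x. x \<in> X \<Longrightarrow> infdist (h x) (G x) \<le> \<epsilon> / 2"
    and t: "t > 0" "\<And>x x'. \<lbrakk>x \<in> X; x' \<in> X; dist x x' \<le> t\<rbrakk> \<Longrightarrow> dist (h x) (h x') \<le> \<sigma>"
    by (rule uniformly_continuous_constrained_selection[where L = L and R = R and X = X and G = G
          and f = f and d = d and C = C and \<epsilon> = "\<epsilon> / 2" and \<sigma> = \<sigma>])
      ((rule L(1) R LR G d uc f \<sigma>(1) half; blast)+, blast)
  obtain k E where k: "E-lipschitz_on UNIV k" "\<And>x. x \<in> X \<Longrightarrow> dist (k x) (h x) \<le> 3 * \<sigma>"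
    by (rule Lipschitz_approximation[where X = X and h = h and t = t and \<sigma> = \<sigma>])
      ((rule \<open>convex X\<close> t; blast)+, blast)
  define g where "g x = k x + R (f x - L (k x))" for x
  have kX: "E-lipschitz_on X k" using k(1) by (rule lipschitz_on_subset) simp
  obtain B\<^sub>R where B\<^sub>R: "B\<^sub>R-lipschitz_on UNIV R" using R.lipschitz_boundE by blast
  obtain B\<^sub>L where B\<^sub>L: "B\<^sub>L-lipschitz_on UNIV L" using L.lipschitz_boundE by blast
  have "(B\<^sub>L * E)-lipschitz_on X (\<lambda>x. L (k x))"
    using lipschitz_on_compose2[OF kX lipschitz_on_subset[OF B\<^sub>L subset_UNIV]] .
  then have "(C + B\<^sub>L * E)-lipschitz_on X (\<lambda>x. f x - L (k x))" by (rule lipschitz_on_diff[OF f(1)])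
  then have "(B\<^sub>R * (C + B\<^sub>L * E))-lipschitz_on X (\<lambda>x. R (f x - L (k x)))"
    using lipschitz_on_compose2[OF _ lipschitz_on_subset[OF B\<^sub>R subset_UNIV]] by blast
  then have "(E + B\<^sub>R * (C + B\<^sub>L * E))-lipschitz_on X g"
    unfolding g_def by (rule lipschitz_on_add[OF kX])
  moreover have "L (g x) = f x" for x by (simp add: g_def L.add LR)
  moreover have "infdist (g x) (G x) < \<epsilon>" if x: "x \<in> X" for x
  proof -
    have "f x - L (k x) = L (h x - k x)" using h(1)[OF x] by (simp add: L.diff)
    then have "dist (g x) (k x) \<le> norm (h x - k x) * A" using A(2) by (simp add: g_def dist_norm)
    also have "\<dots> \<le> 3 * \<sigma> * A"
      using k(2)[OF x] A(1) by (intro mult_right_mono) (auto simp: dist_norm norm_minus_commute)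
    finally have "dist (g x) (h x) \<le> \<epsilon> / 4"
      using dist_triangle[of "g x" "h x" "k x"] k(2)[OF x] \<sigma>(2) by linarith
    then show ?thesis
      using infdist_triangle[of "g x" "G x" "h x"] h(2)[OF x] \<open>\<epsilon> > 0\<close> by linarith
  qed
  ultimately show thesis by (rule that)
qed

section \<open>Selections of Hausdorff-continuous mappings\<close>

text \<open>
  For nonempty bounded sets some radius is admissible in the definition of the Hausdorff distance, so a
  bound on the infimum provides an admissible radius below that bound.
\<close>

lemma near_point_of_hausdorff_distance:
  fixes A B :: "'a::real_normed_vector set"
  assumes "A \<noteq> {}" "bounded A" "B \<noteq> {}" "bounded B" and less: "hausdorff_distance A B < \<eta>" and "y \<in> A"
  shows "\<exists>y'\<in>B. dist y y' \<le> \<eta>"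
proof -
  let ?H = "{h. h > 0 \<and> A \<subseteq> B + cball 0 h \<and> B \<subseteq> A + cball 0 h}"
  obtain c where c: "c > 0" "\<And>a. a \<in> A \<union> B \<Longrightarrow> norm a \<le> c"
    using bounded_pos[of "A \<union> B"] assms(2,4) by auto
  have cover: "P \<subseteq> Q + cball 0 (2 * c)" if "Q \<noteq> {}" "P \<subseteq> A \<union> B" "Q \<subseteq> A \<union> B" for P Q
  proof
    fix p assume "p \<in> P"
    obtain q where "q \<in> Q" using \<open>Q \<noteq> {}\<close> by blast
    have "norm p \<le> c" "norm q \<le> c" using c(2) that \<open>p \<in> P\<close> \<open>q \<in> Q\<close> by auto
    then have "p - q \<in> cball 0 (2 * c)" using norm_triangle_ineq4[of p q] by simp
    then have "q + (p - q) \<in> Q + cball 0 (2 * c)" using \<open>q \<in> Q\<close> by (rule set_plus_intro[rotated])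
    then show "p \<in> Q + cball 0 (2 * c)" by simp
  qed
  have "2 * c \<in> ?H" using c(1) cover assms(1,3) by auto
  then have "?H \<noteq> {}" by blast
  then obtain h where h: "h \<in> ?H" "h < \<eta>"
    using cInf_lessD[of ?H \<eta>] less unfolding hausdorff_distance_def by blast
  then have "y \<in> B + cball 0 h" using \<open>y \<in> A\<close> by blast
  then obtain y' u where "y' \<in> B" "u \<in> cball 0 h" "y = y' + u" by (rule set_plus_elim) 
  then show ?thesis using h(2) by (intro bexI[of _ y']) (auto simp: dist_norm)
qed

text \<open>
  The modulus is controlled only near zero from the right, so coinciding points are treated separately.
\<close>

lemma uniformly_continuous_near_points:
  assumes F: "\<And>x. x \<in> X \<Longrightarrow> F x \<noteq> {} \<and> bounded (F x)"
    and uc: "uniformly_continuous_with_modulus \<omega> X F" and "\<eta> > 0"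
  shows "\<exists>\<delta>>0. \<forall>x\<in>X. \<forall>x'\<in>X. dist x x' < \<delta> \<longrightarrow> (\<forall>y\<in>F x. \<exists>y'\<in>F x'. dist y y' \<le> \<eta>)"
proof -
  have "(\<omega> \<longlongrightarrow> 0) (at_right 0)" using uc by (simp add: uniformly_continuous_with_modulus_def)
  then have "\<forall>\<^sub>F t in at_right 0. \<omega> t < \<eta>" using \<open>\<eta> > 0\<close> by (rule order_tendstoD)
  then obtain \<delta> where \<delta>: "\<delta> > 0" "\<And>t. \<lbrakk>0 < t; t < \<delta>\<rbrakk> \<Longrightarrow> \<omega> t < \<eta>"
    unfolding eventually_at_right_field by blast
  have "\<exists>y'\<in>F x'. dist y y' \<le> \<eta>" if x: "x \<in> X" "x' \<in> X" "dist x x' < \<delta>" "y \<in> F x" for x x' y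
  proof (cases "x = x'")
    case True
    then show ?thesis using that \<open>\<eta> > 0\<close> by (intro bexI[of _ y]) auto
  next
    case False
    then have "hausdorff_distance (F x) (F x') < \<eta>"
      using uc x \<delta>(2)[of "norm (x - x')"]
      by (force simp: uniformly_continuous_with_modulus_def dist_norm)
    then show ?thesis using F x by (intro near_point_of_hausdorff_distance[of "F x"]) auto
  qed
  then show ?thesis using \<delta>(1) by blast
qed

lemma dist_Pair_le: "dist (a, b) (a', b') \<le> dist a a' + dist b b'"
  unfolding dist_Pair_Pair by (rule sqrt_sum_squares_le_sum) auto

theorem theorem3p7:
  fixes X\<^sub>1 :: "'x::{real_inner, complete_space} set"
    and L :: "'y1::{real_inner, complete_space} \<times> 'y2::{real_inner, complete_space}
              \<Rightarrow> 'y::{real_inner, complete_space}"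
    and F\<^sub>1 :: "'x \<Rightarrow> 'y1 set" and F\<^sub>2 :: "'x \<Rightarrow> 'y2 set"
    and \<omega>\<^sub>1 \<omega>\<^sub>2 :: "real \<Rightarrow> real"
    and f :: "'x \<Rightarrow> 'y" and \<epsilon> :: real
  assumes "convex X\<^sub>1"
    and "bounded_linear L" and "surj L"
    and "\<And>x. x \<in> X\<^sub>1 \<Longrightarrow> F\<^sub>1 x \<noteq> {} \<and> convex (F\<^sub>1 x) \<and> closed (F\<^sub>1 x) \<and> bounded (F\<^sub>1 x)"
    and "\<And>x. x \<in> X\<^sub>1 \<Longrightarrow> F\<^sub>2 x \<noteq> {} \<and> convex (F\<^sub>2 x) \<and> closed (F\<^sub>2 x) \<and> bounded (F\<^sub>2 x)"
    and "uniformly_continuous_with_modulus \<omega>\<^sub>1 X\<^sub>1 F\<^sub>1"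
    and "uniformly_continuous_with_modulus \<omega>\<^sub>2 X\<^sub>1 F\<^sub>2"
    and "bdd_above ((\<lambda>x. diameter (F\<^sub>1 x \<times> F\<^sub>2 x)) ` X\<^sub>1)"
    and "lipschitz_selection_on X\<^sub>1 (\<lambda>x. L ` (F\<^sub>1 x \<times> F\<^sub>2 x)) f"
    and "\<epsilon> > 0"
  shows "\<exists>f\<^sub>1 f\<^sub>2.
           lipschitz_selection_on X\<^sub>1 (\<lambda>x. F\<^sub>1 x + cball 0 \<epsilon>) f\<^sub>1 \<and>
           lipschitz_selection_on X\<^sub>1 (\<lambda>x. F\<^sub>2 x + cball 0 \<epsilon>) f\<^sub>2 \<and>
           (\<forall>x\<in>X\<^sub>1. f x = L (f\<^sub>1 x, f\<^sub>2 x))"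
proof -
  note F\<^sub>1 = assms(4) and F\<^sub>2 = assms(5)
  define G where "G x = F\<^sub>1 x \<times> F\<^sub>2 x" for x
  have G: "convex (G x) \<and> bounded (G x)" if "x \<in> X\<^sub>1" for x
    using F\<^sub>1[OF that] F\<^sub>2[OF that] by (auto simp: G_def intro: convex_Times bounded_Times)
  obtain d where d: "\<And>x. x \<in> X\<^sub>1 \<Longrightarrow> diameter (G x) \<le> d"
    using assms(8) unfolding bdd_above_def G_def by auto
  have diam: "dist y y' \<le> d" if "x \<in> X\<^sub>1" "y \<in> G x" "y' \<in> G x" for x y y'
    using diameter_bounded_bound[of "G x" y y'] G d that by (meson order_trans)
  have uc: "\<exists>\<delta>>0. \<forall>x\<in>X\<^sub>1. \<forall>x'\<in>X\<^sub>1. dist x x' < \<delta> \<longrightarrow> (\<forall>y\<in>G x. \<exists>y'\<in>G x'. dist y y' \<le> \<eta>)"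
    if "\<eta> > 0" for \<eta>
  proof -
    have half: "\<eta> / 2 > 0" using that by simp
    obtain \<delta>\<^sub>1 where \<delta>\<^sub>1: "\<delta>\<^sub>1 > 0" "\<And>x x' y. \<lbrakk>x \<in> X\<^sub>1; x' \<in> X\<^sub>1; dist x x' < \<delta>\<^sub>1; y \<in> F\<^sub>1 x\<rbrakk>
        \<Longrightarrow> \<exists>y'\<in>F\<^sub>1 x'. dist y y' \<le> \<eta> / 2"
      using uniformly_continuous_near_points[OF _ assms(6) half] F\<^sub>1 by metis
    obtain \<delta>\<^sub>2 where \<delta>\<^sub>2: "\<delta>\<^sub>2 > 0" "\<And>x x' y. \<lbrakk>x \<in> X\<^sub>1; x' \<in> X\<^sub>1; dist x x' < \<delta>\<^sub>2; y \<in> F\<^sub>2 x\<rbrakk>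
        \<Longrightarrow> \<exists>y'\<in>F\<^sub>2 x'. dist y y' \<le> \<eta> / 2"
      using uniformly_continuous_near_points[OF _ assms(7) half] F\<^sub>2 by metis
    have "\<exists>y'\<in>G x'. dist y y' \<le> \<eta>"
      if x: "x \<in> X\<^sub>1" "x' \<in> X\<^sub>1" "dist x x' < min \<delta>\<^sub>1 \<delta>\<^sub>2" and y: "y \<in> G x" for x x' y
    proof -
      obtain a b where ab: "y = (a, b)" "a \<in> F\<^sub>1 x" "b \<in> F\<^sub>2 x" using y by (auto simp: G_def)
      obtain a' where a': "a' \<in> F\<^sub>1 x'" "dist a a' \<le> \<eta> / 2" using \<delta>\<^sub>1(2)[OF x(1,2) _ ab(2)] x(3) by auto
      obtain b' where b': "b' \<in> F\<^sub>2 x'" "dist b b' \<le> \<eta> / 2" using \<delta>\<^sub>2(2)[OF x(1,2) _ ab(3)] x(3) by auto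
      have "dist y (a', b') \<le> \<eta>" using dist_Pair_le[of a b a' b'] a'(2) b'(2) unfolding ab(1) by linarith
      then show ?thesis using a' b' by (intro bexI[of _ "(a', b')"]) (auto simp: G_def)
    qed
    then show ?thesis using \<delta>\<^sub>1(1) \<delta>\<^sub>2(1) by (intro exI[of _ "min \<delta>\<^sub>1 \<delta>\<^sub>2"]) auto
  qed
  obtain C where C: "C-lipschitz_on X\<^sub>1 f" and sel: "\<And>x. x \<in> X\<^sub>1 \<Longrightarrow> f x \<in> L ` G x"
    using assms(9) by (auto simp: lipschitz_selection_on_def G_def)
  obtain g D where g: "D-lipschitz_on X\<^sub>1 g" "\<And>x. x \<in> X\<^sub>1 \<Longrightarrow> L (g x) = f x"
      "\<And>x. x \<in> X\<^sub>1 \<Longrightarrow> infdist (g x) (G x) < \<epsilon>"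
    by (rule Lipschitz_splitting[where L = L and X = X\<^sub>1 and G = G and f = f and d = d and C = C
          and \<epsilon> = \<epsilon>])
      ((rule assms(1-3) G diam uc C sel assms(10); blast)+, blast)
  have near: "fst (g x) \<in> F\<^sub>1 x + cball 0 \<epsilon> \<and> snd (g x) \<in> F\<^sub>2 x + cball 0 \<epsilon>" if x: "x \<in> X\<^sub>1" for x
  proof -
    have "G x \<noteq> {}" using F\<^sub>1[OF x] F\<^sub>2[OF x] by (auto simp: G_def)
    then obtain y where y: "y \<in> G x" "dist (g x) y < \<epsilon>" using exists_near_infdist g(3)[OF x] by blast
    have "norm (fst (g x) - fst y) \<le> \<epsilon>" "norm (snd (g x) - snd y) \<le> \<epsilon>"
      using y(2) dist_fst_le[of "g x" y] dist_snd_le[of "g x" y] by (simp_all add: dist_norm)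
    then have "fst (g x) - fst y \<in> cball 0 \<epsilon>" "snd (g x) - snd y \<in> cball 0 \<epsilon>" by simp_all
    moreover have "fst y \<in> F\<^sub>1 x" "snd y \<in> F\<^sub>2 x" using y(1) by (auto simp: G_def)
    ultimately have "fst y + (fst (g x) - fst y) \<in> F\<^sub>1 x + cball 0 \<epsilon>"
        "snd y + (snd (g x) - snd y) \<in> F\<^sub>2 x + cball 0 \<epsilon>"
      by (blast intro: set_plus_intro)+
    then show ?thesis by simp
  qed
  have "D-lipschitz_on X\<^sub>1 (\<lambda>x. fst (g x))" "D-lipschitz_on X\<^sub>1 (\<lambda>x. snd (g x))"
    using lipschitz_onD[OF g(1)] lipschitz_on_nonneg[OF g(1)]
    by (auto intro!: lipschitz_onI intro: order_trans[OF dist_fst_le] order_trans[OF dist_snd_le])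
  then show ?thesis
    using near g(2) by (intro exI[of _ "\<lambda>x. fst (g x)"] exI[of _ "\<lambda>x. snd (g x)"])
      (auto simp: lipschitz_selection_on_def)
qed

end
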